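(* Let $\Bbbk$ be an arbitrary field and let $V$ be a simple finite-dimensional associative double algebra over $\Bbbk$. Then $V$ is commutative.
   Context: A double algebra over a field $\Bbbk$ is a linear space $V$ with a linear map (double bracket) $V\otimes V\to V\otimes V$, $a\otimes b\mapsto \{\!\{a,b\}\!\}$. An ideal of $V$ is a subspace $I\subseteq V$ such that $\{\!\{v,w\}\!\}\in I\otimes V+V\otimes I$ whenever $v\in I$, $w\in V$ or $v\in V$, $w\in I$; it is proper if $I\neq V$. $V$ is simple if the double bracket is not identically zero and $V$ has no nonzero proper ideals. For $u\in V^{\otimes n}$ and $\sigma\in S_n$, $u^\sigma$ denotes the result of permuting the tensor factors of $u$ by $\sigma$ (e.g. $u^{(12)}$ interchanges the first two factors). The double bracket is extended linearly to four maps $V^{\otimes 3}\to V^{\otimes 3}$ by $\{\!\{a,b\otimes c\}\!\}_L=\{\!\{a,b\}\!\}\otimes c$, $\{\!\{a,b\otimes c\}\!\}_R=(b\otimes\{\!\{a,c\}\!\})^{(12)}$, $\{\!\{a\otimes b,c\}\!\}_L=(\{\!\{a,c\}\!\}\otimes b)^{(23)}$, $\{\!\{a\otimes b,c\}\!\}_R=a\otimes\{\!\{b,c\}\!\}$. $V$ is associative if for all $a,b,c\in V$: $\{\!\{a,\{\!\{b,c\}\!\}\}\!\}_L=\{\!\{\{\!\{a,b\}\!\},c\}\!\}_L$ and $\{\!\{a,\{\!\{b,c\}\!\}\}\!\}_R=\{\!\{\{\!\{a,b\}\!\},c\}\!\}_R$. An associative double algebra $V$ is commutative if in addition $\{\!\{a,b\}\!\}=\{\!\{b,a\}\!\}^{(12)}$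 for all $a,b\in V$. *)

theory Defs
  imports Complex_Main "HOL-Library.Function_Algebras" "HOL-Combinatorics.Permutations"
begin

section \<open>Tensor powers of a vector space\<close>

definition fun_scale :: "'k::field \<Rightarrow> ('x \<Rightarrow> 'k) \<Rightarrow> ('x \<Rightarrow> 'k)" where
  "fun_scale c f = (\<lambda>x. c * f x)"

global_interpretation fn: vector_space "fun_scale :: 'k::field \<Rightarrow> ('x \<Rightarrow> 'k) \<Rightarrow> ('x \<Rightarrow> 'k)"
  by unfold_locales (auto simp: fun_scale_def fun_eq_iff algebra_simps)

text \<open>
  HOL types cannot depend on the scalar multiplication of \<open>V\<close>, so \<open>V\<otimes>\<dots>\<otimes>V\<close> (\<open>n\<close> factors) is
  realised as a subspace of a fixed function space: \<open>x\<^sub>1 \<otimes> \<dots> \<otimes> x\<^sub>n\<close> is the evaluation functional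
  \<open>\<beta> \<mapsto> \<beta>(x\<^sub>1, \<dots>, x\<^sub>n)\<close> on \<open>n\<close>-linear forms (extended by \<open>0\<close> to all other functions), and the
  tensor power is the linear span of these.  Lemmas \<open>multilinear_pure\<close>, \<open>tensor_lift_linear\<close>,
  \<open>tensor_lift_pure\<close> and \<open>tensor_ext\<close> below give its universal property for every
  vector space \<open>V\<close> and every target space.
\<close>

type_synonym ('v, 'k) tensor = "('v list \<Rightarrow> 'k) \<Rightarrow> 'k"

locale tensor_powers = vector_space scale
  for scale :: "'k::field \<Rightarrow> 'v::ab_group_add \<Rightarrow> 'v"
begin

text \<open>Only the values on lists of length \<open>n\<close> matter.\<close>

definition multilinear ::
    "nat \<Rightarrow> ('k \<Rightarrow> 'w::ab_group_add \<Rightarrow> 'w) \<Rightarrow> ('v list \<Rightarrow> 'w) \<Rightarrow> bool" where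
  "multilinear n scaleW f \<longleftrightarrow>
     (\<forall>xs i. length xs = n \<longrightarrow> i < n \<longrightarrow>
        Vector_Spaces.linear scale scaleW (\<lambda>x. f (xs[i := x])))"

definition pure :: "'v list \<Rightarrow> ('v, 'k) tensor" where
  "pure xs = (\<lambda>\<beta>. if multilinear (length xs) (*) \<beta> then \<beta> xs else 0)"

definition tensor_power :: "nat \<Rightarrow> ('v, 'k) tensor set" where
  "tensor_power n = fn.span (pure ` {xs. length xs = n})"

text \<open>
  The linear map on \<open>tensor_power n\<close> sending \<open>pure xs\<close> to \<open>f xs\<close>, for \<open>f\<close> multilinear; its values
  outside \<open>tensor_power n\<close> are irrelevant.
\<close>

definition tensor_lift ::
    "nat \<Rightarrow> ('k \<Rightarrow> 'w::ab_group_add \<Rightarrow> 'w) \<Rightarrow> ('v list \<Rightarrow> 'w) \<Rightarrow> ('v, 'k) tensor \<Rightarrow> 'w" where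
  "tensor_lift n scaleW f =
     (SOME g. Vector_Spaces.linear fun_scale scaleW g \<and> (\<forall>xs. length xs = n \<longrightarrow> g (pure xs) = f xs))"

definition tensor_perm :: "nat \<Rightarrow> (nat \<Rightarrow> nat) \<Rightarrow> ('v, 'k) tensor \<Rightarrow> ('v, 'k) tensor" where
  "tensor_perm n \<sigma> = tensor_lift n fun_scale (\<lambda>xs. pure (permute_list \<sigma> xs))"

text \<open>\<open>a \<otimes> u\<close> and \<open>u \<otimes> a\<close> for \<open>a \<in> V\<close> and \<open>u\<close> in the \<open>n\<close>-th tensor power.\<close>

definition tensor_cons :: "nat \<Rightarrow> 'v \<Rightarrow> ('v, 'k) tensor \<Rightarrow> ('v, 'k) tensor" where
  "tensor_cons n a = tensor_lift n fun_scale (\<lambda>xs. pure (a # xs))"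

definition tensor_snoc :: "nat \<Rightarrow> ('v, 'k) tensor \<Rightarrow> 'v \<Rightarrow> ('v, 'k) tensor" where
  "tensor_snoc n u a = tensor_lift n fun_scale (\<lambda>xs. pure (xs @ [a])) u"

text \<open>The subspace \<open>I \<otimes> J\<close> of \<open>V \<otimes> V\<close>, for subspaces \<open>I\<close>, \<open>J\<close> of \<open>V\<close>.\<close>

definition tensor_subspace :: "'v set \<Rightarrow> 'v set \<Rightarrow> ('v, 'k) tensor set" where
  "tensor_subspace I J = fn.span {pure [x, y] | x y. x \<in> I \<and> y \<in> J}"

end


section \<open>Double algebras\<close>

text \<open>
  The double bracket is a map on the carrier \<open>V \<otimes> V = tensor_power 2\<close>, linear there.
  Indices of tensor factors start at \<open>0\<close>, so the permutation \<open>(12)\<close> is \<open>transpose 0 1\<close>.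
\<close>

locale double_algebra = tensor_powers scale
  for scale :: "'k::field \<Rightarrow> 'v::ab_group_add \<Rightarrow> 'v" +
  fixes D :: "('v, 'k) tensor \<Rightarrow> ('v, 'k) tensor"
  assumes D_closed: "t \<in> tensor_power 2 \<Longrightarrow> D t \<in> tensor_power 2"
    and D_add: "t \<in> tensor_power 2 \<Longrightarrow> u \<in> tensor_power 2 \<Longrightarrow> D (t + u) = D t + D u"
    and D_scale: "t \<in> tensor_power 2 \<Longrightarrow> D (fun_scale c t) = fun_scale c (D t)"
begin

definition bracket :: "'v \<Rightarrow> 'v \<Rightarrow> ('v, 'k) tensor" where
  "bracket a b = D (pure [a, b])"

text \<open>
  The four extensions of the bracket to maps on \<open>V \<otimes> V \<otimes> V\<close>: the first two are the maps
  \<open>a \<otimes> u \<mapsto> {{a, u}}\<close>, the last two the maps \<open>u \<otimes> c \<mapsto> {{u, c}}\<close>, for \<open>u \<in> V \<otimes> V\<close>.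
\<close>

definition ext_right_L :: "('v, 'k) tensor \<Rightarrow> ('v, 'k) tensor" where
  "ext_right_L = tensor_lift 3 fun_scale
     (\<lambda>xs. tensor_snoc 2 (bracket (xs ! 0) (xs ! 1)) (xs ! 2))"

definition ext_right_R :: "('v, 'k) tensor \<Rightarrow> ('v, 'k) tensor" where
  "ext_right_R = tensor_lift 3 fun_scale
     (\<lambda>xs. tensor_perm 3 (transpose 0 1) (tensor_cons 2 (xs ! 1) (bracket (xs ! 0) (xs ! 2))))"

definition ext_left_L :: "('v, 'k) tensor \<Rightarrow> ('v, 'k) tensor" where
  "ext_left_L = tensor_lift 3 fun_scale
     (\<lambda>xs. tensor_perm 3 (transpose 1 2) (tensor_snoc 2 (bracket (xs ! 0) (xs ! 2)) (xs ! 1)))"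

definition ext_left_R :: "('v, 'k) tensor \<Rightarrow> ('v, 'k) tensor" where
  "ext_left_R = tensor_lift 3 fun_scale
     (\<lambda>xs. tensor_cons 2 (xs ! 0) (bracket (xs ! 1) (xs ! 2)))"

definition bracket_right_L :: "'v \<Rightarrow> ('v, 'k) tensor \<Rightarrow> ('v, 'k) tensor" where
  "bracket_right_L a u = ext_right_L (tensor_cons 2 a u)"

definition bracket_right_R :: "'v \<Rightarrow> ('v, 'k) tensor \<Rightarrow> ('v, 'k) tensor" where
  "bracket_right_R a u = ext_right_R (tensor_cons 2 a u)"

definition bracket_left_L :: "('v, 'k) tensor \<Rightarrow> 'v \<Rightarrow> ('v, 'k) tensor" where
  "bracket_left_L u c = ext_left_L (tensor_snoc 2 u c)"

definition bracket_left_R :: "('v, 'k) tensor \<Rightarrow> 'v \<Rightarrow> ('v, 'k) tensor" where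
  "bracket_left_R u c = ext_left_R (tensor_snoc 2 u c)"

definition ideal :: "'v set \<Rightarrow> bool" where
  "ideal I \<longleftrightarrow> subspace I \<and>
     (\<forall>v w. v \<in> I \<or> w \<in> I \<longrightarrow>
        (\<exists>p \<in> tensor_subspace I UNIV. \<exists>q \<in> tensor_subspace UNIV I. bracket v w = p + q))"

definition simple :: bool where
  "simple \<longleftrightarrow> (\<exists>a b. bracket a b \<noteq> 0) \<and> (\<forall>I. ideal I \<longrightarrow> I = {0} \<or> I = UNIV)"

definition associative :: bool where
  "associative \<longleftrightarrow>
     (\<forall>a b c. bracket_right_L a (bracket b c) = bracket_left_L (bracket a b) c \<and>
              bracket_right_R a (bracket b c) = bracket_left_R (bracket a b) c)"

definition commutative :: bool where
  "commutative \<longleftrightarrow> associative \<and>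
     (\<forall>a b. bracket a b = tensor_perm 2 (transpose 0 1) (bracket b a))"

end


section \<open>The universal property and the generator formulas\<close>

lemma vector_space_times: "vector_space ((*) :: 'k::field \<Rightarrow> 'k \<Rightarrow> 'k)"
  by unfold_locales (auto simp: algebra_simps)

lemma functional_separates:
  fixes scaleW :: "'k::field \<Rightarrow> 'w::ab_group_add \<Rightarrow> 'w"
  assumes "vector_space scaleW" and "w \<noteq> 0"
  obtains \<phi> :: "'w \<Rightarrow> 'k" where "Vector_Spaces.linear scaleW (*) \<phi>" "\<phi> w = 1"
proof -
  interpret W: vector_space scaleW by fact
  interpret K: vector_space "(*) :: 'k \<Rightarrow> 'k \<Rightarrow> 'k" by (rule vector_space_times)
  interpret P: vector_space_pair scaleW "(*) :: 'k \<Rightarrow> 'k \<Rightarrow> 'k" ..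
  have ind: "W.independent {w}" using assms(2) by simp
  show thesis
    by (rule that[OF P.linear_construct[OF ind, of "\<lambda>_. 1"]])
      (simp add: P.construct_basis[OF ind])
qed

lemma linear_comp:
  assumes "Vector_Spaces.linear s1 s2 f" "Vector_Spaces.linear s2 s3 g"
  shows "Vector_Spaces.linear s1 s3 (\<lambda>x. g (f x))"
  using Vector_Spaces.linear_compose[OF assms] by (simp add: o_def)

context tensor_powers
begin

lemma multilinear_comp:
  assumes "multilinear n s2 f" "Vector_Spaces.linear s2 s3 g"
  shows "multilinear n s3 (\<lambda>xs. g (f xs))"
  unfolding multilinear_def
proof (intro allI impI)
  fix xs :: "'v list" and i assume "length xs = n" "i < n"
  then have "Vector_Spaces.linear scale s2 (\<lambda>x. f (xs[i := x]))"
    using assms(1) by (simp add: multilinear_def)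
  then show "Vector_Spaces.linear scale s3 (\<lambda>x. g (f (xs[i := x])))"
    by (rule linear_comp) (rule assms(2))
qed

lemma multilinear_pure: "multilinear n fun_scale pure"
  unfolding multilinear_def
proof (intro allI impI)
  fix xs :: "'v list" and i assume *: "length xs = n" "i < n"
  have lin: "Vector_Spaces.linear scale (*) (\<lambda>x. \<beta> (xs[i := x]))" if "multilinear n (*) \<beta>"
    for \<beta> :: "'v list \<Rightarrow> 'k"
    using that * by (auto simp: multilinear_def)
  show "Vector_Spaces.linear scale fun_scale (\<lambda>x. pure (xs[i := x]))"
  proof (unfold_locales, goal_cases)
    case (1 x y)
    show ?case
    proof
      fix \<beta> :: "'v list \<Rightarrow> 'k"
      show "pure (xs[i := x + y]) \<beta> = (pure (xs[i := x]) + pure (xs[i := y])) \<beta>"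
      proof (cases "multilinear n (*) \<beta>")
        case True
        interpret Vector_Spaces.linear scale "(*)" "\<lambda>x. \<beta> (xs[i := x])" by (rule lin[OF True])
        show ?thesis using True * add by (simp add: pure_def)
      qed (simp add: pure_def *)
    qed
  next
    case (2 c x)
    show ?case
    proof
      fix \<beta> :: "'v list \<Rightarrow> 'k"
      show "pure (xs[i := scale c x]) \<beta> = fun_scale c (pure (xs[i := x])) \<beta>"
      proof (cases "multilinear n (*) \<beta>")
        case True
        interpret l: Vector_Spaces.linear scale "(*)" "\<lambda>x. \<beta> (xs[i := x])" by (rule lin[OF True])
        show ?thesis using True * l.scale by (simp add: pure_def fun_scale_def)
      qed (simp add: pure_def * fun_scale_def)
    qed
  qed
qed

lemma tensor_lift_exists:
  fixes scaleW :: "'k \<Rightarrow> 'w::ab_group_add \<Rightarrow> 'w"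
  assumes W: "vector_space scaleW" and f: "multilinear n scaleW f"
  shows "\<exists>g. Vector_Spaces.linear fun_scale scaleW g \<and> (\<forall>xs. length xs = n \<longrightarrow> g (pure xs) = f xs)"
proof -
  interpret W: vector_space scaleW by fact
  interpret P: vector_space_pair "fun_scale :: 'k \<Rightarrow> ('v, 'k) tensor \<Rightarrow> _" scaleW ..
  let ?P = "pure ` {xs. length xs = n}"
  obtain B where B: "B \<subseteq> ?P" "fn.independent B" "?P \<subseteq> fn.span B"
    using fn.maximal_independent_subset[of ?P] by blast
  have "\<forall>b\<in>B. \<exists>xs. length xs = n \<and> pure xs = b" using B(1) by blast
  then obtain r where r: "\<And>b. b \<in> B \<Longrightarrow> length (r b) = n \<and> pure (r b) = b" by metis
  define g where "g = P.construct B (\<lambda>b. f (r b))"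
  have lin: "Vector_Spaces.linear fun_scale scaleW g"
    unfolding g_def by (rule P.linear_construct[OF B(2)])
  interpret g: Vector_Spaces.linear fun_scale scaleW g by (rule lin)
  have "g (pure xs) = f xs" if n: "length xs = n" for xs
  proof (rule ccontr)
    assume ne: "g (pure xs) \<noteq> f xs"
    have "pure xs \<in> fn.span B" using n B(3) by blast
    then obtain S c where S: "finite S" "S \<subseteq> B" and eq: "pure xs = (\<Sum>b\<in>S. fun_scale (c b) b)"
      unfolding fn.span_explicit by blast
    have gx: "g (pure xs) = (\<Sum>b\<in>S. scaleW (c b) (f (r b)))"
      unfolding eq g.sum g.scale using S
      by (intro sum.cong refl) (auto simp: g_def P.construct_basis[OF B(2)])
    obtain \<phi> where \<phi>: "Vector_Spaces.linear scaleW (*) \<phi>" "\<phi> (g (pure xs) - f xs) = 1"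
      using functional_separates[OF W, of "g (pure xs) - f xs"] ne by auto
    interpret \<phi>: Vector_Spaces.linear scaleW "(*)" \<phi> by (rule \<phi>(1))
    define \<beta> where "\<beta> = (\<lambda>xs. \<phi> (f xs))"
    have \<beta>: "multilinear n (*) \<beta>"
      unfolding \<beta>_def by (rule multilinear_comp[OF f \<phi>(1)])
    have ev: "b \<beta> = \<phi> (f (r b))" if "b \<in> B" for b
    proof -
      have "b \<beta> = pure (r b) \<beta>" using r[OF that] by simp
      also have "\<dots> = \<phi> (f (r b))" using r[OF that] \<beta> by (simp add: pure_def \<beta>_def)
      finally show ?thesis .
    qed
    have sum_ev: "(\<Sum>b\<in>A. fun_scale (c b) b) \<beta> = (\<Sum>b\<in>A. c b * b \<beta>)" if "finite A" for A
      using that by (induction A rule: finite_induct) (auto simp: fun_scale_def)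
    have "\<phi> (f xs) = pure xs \<beta>" using \<beta> n by (simp add: pure_def \<beta>_def)
    also have "\<dots> = (\<Sum>b\<in>S. c b * b \<beta>)" unfolding eq by (rule sum_ev[OF S(1)])
    also have "\<dots> = (\<Sum>b\<in>S. c b * \<phi> (f (r b)))" using S(2) ev by (intro sum.cong) auto
    also have "\<dots> = \<phi> (g (pure xs))" unfolding gx \<phi>.sum \<phi>.scale ..
    finally show False using \<phi>(2) by (simp add: \<phi>.diff)
  qed
  with lin show ?thesis by blast
qed

lemma
  assumes "vector_space scaleW" and "multilinear n scaleW f"
  shows tensor_lift_linear: "Vector_Spaces.linear fun_scale scaleW (tensor_lift n scaleW f)"
    and tensor_lift_pure: "length xs = n \<Longrightarrow> tensor_lift n scaleW f (pure xs) = f xs"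
  using someI_ex[OF tensor_lift_exists[OF assms]] unfolding tensor_lift_def by auto

lemma tensor_ext:
  assumes "vector_space scaleW"
    and g: "\<And>t u. t \<in> tensor_power n \<Longrightarrow> u \<in> tensor_power n \<Longrightarrow> g (t + u) = g t + g u"
      "\<And>c t. t \<in> tensor_power n \<Longrightarrow> g (fun_scale c t) = scaleW c (g t)"
    and h: "\<And>t u. t \<in> tensor_power n \<Longrightarrow> u \<in> tensor_power n \<Longrightarrow> h (t + u) = h t + h u"
      "\<And>c t. t \<in> tensor_power n \<Longrightarrow> h (fun_scale c t) = scaleW c (h t)"
    and gh: "\<And>xs. length xs = n \<Longrightarrow> g (pure xs) = h (pure xs)"
    and t: "t \<in> tensor_power n"
  shows "g t = h t"
proof -
  interpret W: vector_space scaleW by fact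
  have z: "0 \<in> tensor_power n" unfolding tensor_power_def by (rule fn.span_zero)
  have "g 0 = 0" "h 0 = 0" using g(2)[OF z, of 0] h(2)[OF z, of 0] by auto
  have "t \<in> tensor_power n \<and> g t = h t"
    using t unfolding tensor_power_def
  proof (induction rule: fn.span_induct_alt)
    case base
    from z \<open>g 0 = 0\<close> \<open>h 0 = 0\<close> show ?case unfolding tensor_power_def by metis
  next
    case (step c x y)
    have x: "x \<in> tensor_power n" "g x = h x"
      using step(1) gh by (auto simp: tensor_power_def intro: fn.span_base)
    have cx: "fun_scale c x \<in> tensor_power n"
      using x(1) unfolding tensor_power_def by (rule fn.span_scale)
    have y: "y \<in> tensor_power n" "g y = h y" using step by (auto simp: tensor_power_def)
    have "g (fun_scale c x + y) = h (fun_scale c x + y)"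
      using g(1)[OF cx y(1)] h(1)[OF cx y(1)] g(2)[OF x(1)] h(2)[OF x(1)] x(2) y(2) by simp
    then show ?case
      using cx y(1) unfolding tensor_power_def by (blast intro: fn.span_add)
  qed
  then show ?thesis ..
qed

lemma pure_in_tensor_power: "length xs = n \<Longrightarrow> pure xs \<in> tensor_power n"
  unfolding tensor_power_def by (rule fn.span_base) blast

lemma multilinear_pure_cons: "multilinear n fun_scale (\<lambda>xs. pure (a # xs))"
  unfolding multilinear_def
proof (intro allI impI, goal_cases)
  case (1 xs i)
  then have "Vector_Spaces.linear scale fun_scale (\<lambda>x. pure ((a # xs)[Suc i := x]))"
    by (intro multilinear_pure[of "Suc n", unfolded multilinear_def, rule_format]) simp_all
  then show ?case by simp
qed

lemma multilinear_pure_snoc: "multilinear n fun_scale (\<lambda>xs. pure (xs @ [a]))"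
  unfolding multilinear_def
proof (intro allI impI, goal_cases)
  case (1 xs i)
  then have "Vector_Spaces.linear scale fun_scale (\<lambda>x. pure ((xs @ [a])[i := x]))"
    by (intro multilinear_pure[of "Suc n", unfolded multilinear_def, rule_format]) simp_all
  with 1 show ?case by (simp add: list_update_append)
qed

lemma multilinear_pure_perm:
  assumes \<sigma>: "\<sigma> permutes {..<n}"
  shows "multilinear n fun_scale (\<lambda>xs. pure (permute_list \<sigma> xs))"
  unfolding multilinear_def
proof (intro allI impI, goal_cases)
  case (1 xs i)
  let ?j = "inv \<sigma> i"
  have j: "?j < n" using 1 permutes_in_image[OF permutes_inv[OF \<sigma>], of i] by simp
  have eq: "permute_list \<sigma> (xs[i := x]) = (permute_list \<sigma> xs)[?j := x]" for x
  proof (rule nth_equalityI)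
    fix k assume "k < length (permute_list \<sigma> (xs[i := x]))"
    then have k: "k < n" using 1 by simp
    have "\<sigma> k < n" using k permutes_in_image[OF \<sigma>, of k] by simp
    moreover have "\<sigma> k = i \<longleftrightarrow> k = ?j" using permutes_inverses[OF \<sigma>] by metis
    ultimately show "permute_list \<sigma> (xs[i := x]) ! k = (permute_list \<sigma> xs)[?j := x] ! k"
      using 1 k \<sigma> j by (auto simp: permute_list_nth nth_list_update permute_list_def)
  qed simp
  show ?case unfolding eq
    by (rule multilinear_pure[of n, unfolded multilinear_def, rule_format]) (simp_all add: 1 j)
qed

lemma tensor_cons_pure [simp]: "length xs = n \<Longrightarrow> tensor_cons n a (pure xs) = pure (a # xs)"
  unfolding tensor_cons_def
  by (rule tensor_lift_pure[OF fn.vector_space_axioms multilinear_pure_cons])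

lemma tensor_snoc_pure [simp]: "length xs = n \<Longrightarrow> tensor_snoc n (pure xs) a = pure (xs @ [a])"
  unfolding tensor_snoc_def
  by (rule tensor_lift_pure[OF fn.vector_space_axioms multilinear_pure_snoc])

lemma tensor_perm_pure:
  "\<sigma> permutes {..<n} \<Longrightarrow> length xs = n \<Longrightarrow> tensor_perm n \<sigma> (pure xs) = pure (permute_list \<sigma> xs)"
  unfolding tensor_perm_def
  by (rule tensor_lift_pure[OF fn.vector_space_axioms multilinear_pure_perm])

lemma linear_tensor_cons: "Vector_Spaces.linear fun_scale fun_scale (tensor_cons n a)"
  unfolding tensor_cons_def
  by (rule tensor_lift_linear[OF fn.vector_space_axioms multilinear_pure_cons])

lemma linear_tensor_snoc: "Vector_Spaces.linear fun_scale fun_scale (\<lambda>u. tensor_snoc n u a)"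
  unfolding tensor_snoc_def
  by (rule tensor_lift_linear[OF fn.vector_space_axioms multilinear_pure_snoc])

lemma linear_tensor_perm:
  "\<sigma> permutes {..<n} \<Longrightarrow> Vector_Spaces.linear fun_scale fun_scale (tensor_perm n \<sigma>)"
  unfolding tensor_perm_def
  by (rule tensor_lift_linear[OF fn.vector_space_axioms multilinear_pure_perm])

text \<open>\<open>a \<otimes> u\<close> and \<open>u \<otimes> a\<close> are linear in \<open>a\<close> too, for \<open>u\<close> in the tensor power.\<close>

lemma linear_tensor_cons_left:
  assumes "u \<in> tensor_power n"
  shows "Vector_Spaces.linear scale fun_scale (\<lambda>a. tensor_cons n a u)"
proof -
  have *: "Vector_Spaces.linear scale fun_scale (\<lambda>a. pure (a # xs))" if "length xs = n" for xs
    using multilinear_pure[of "Suc n", unfolded multilinear_def, rule_format, of "0 # xs" 0] that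
    by simp
  interpret C: Vector_Spaces.linear fun_scale fun_scale "tensor_cons n a" for a
    by (rule linear_tensor_cons)
  interpret P: vector_space_pair scale "fun_scale :: 'k \<Rightarrow> ('v, 'k) tensor \<Rightarrow> _" ..
  show ?thesis
    using assms unfolding tensor_power_def
  proof (induction rule: fn.span_induct_alt)
    case base
    show ?case unfolding C.zero by unfold_locales (simp_all only: add_0 fn.scale_zero_right)
  next
    case (step c x y)
    from step(1) obtain xs where "x = pure xs" "length xs = n" by blast
    then have "Vector_Spaces.linear scale fun_scale (\<lambda>a. tensor_cons n a x)"
      using * by simp
    from P.linear_compose_add[OF P.linear_compose_scale_right[OF this] step(2)] show ?case
      unfolding C.add C.scale .
  qed
qed

lemma linear_tensor_snoc_right:
  assumes "u \<in> tensor_power n"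
  shows "Vector_Spaces.linear scale fun_scale (\<lambda>a. tensor_snoc n u a)"
proof -
  have *: "Vector_Spaces.linear scale fun_scale (\<lambda>a. pure (xs @ [a]))" if "length xs = n" for xs
  proof -
    have "Vector_Spaces.linear scale fun_scale (\<lambda>a. pure ((xs @ [0])[n := a]))"
      by (rule multilinear_pure[of "Suc n", unfolded multilinear_def, rule_format])
        (simp_all add: that)
    then show ?thesis using that by (simp add: list_update_append)
  qed
  interpret C: Vector_Spaces.linear fun_scale fun_scale "\<lambda>u. tensor_snoc n u a" for a
    by (rule linear_tensor_snoc)
  interpret P: vector_space_pair scale "fun_scale :: 'k \<Rightarrow> ('v, 'k) tensor \<Rightarrow> _" ..
  show ?thesis
    using assms unfolding tensor_power_def
  proof (induction rule: fn.span_induct_alt)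
    case base
    show ?case unfolding C.zero by unfold_locales (simp_all only: add_0 fn.scale_zero_right)
  next
    case (step c x y)
    from step(1) obtain xs where "x = pure xs" "length xs = n" by blast
    then have "Vector_Spaces.linear scale fun_scale (\<lambda>a. tensor_snoc n x a)"
      using * by simp
    from P.linear_compose_add[OF P.linear_compose_scale_right[OF this] step(2)] show ?case
      unfolding C.add C.scale .
  qed
qed

lemma multilinear3I:
  assumes "\<And>y z. Vector_Spaces.linear scale s (\<lambda>x. f x y z)"
    and "\<And>x z. Vector_Spaces.linear scale s (\<lambda>y. f x y z)"
    and "\<And>x y. Vector_Spaces.linear scale s (\<lambda>z. f x y z)"
  shows "multilinear 3 s (\<lambda>xs. f (xs ! 0) (xs ! 1) (xs ! 2))"
  unfolding multilinear_def
proof (intro allI impI)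
  fix xs :: "'v list" and i :: nat assume "length xs = 3" "i < 3"
  then obtain x y z where "xs = [x, y, z]" by (auto simp: numeral_3_eq_3 length_Suc_conv)
  moreover from \<open>i < 3\<close> have "i = 0 \<or> i = 1 \<or> i = 2" by auto
  ultimately show "Vector_Spaces.linear scale s
      (\<lambda>x. f (xs[i := x] ! 0) (xs[i := x] ! 1) (xs[i := x] ! 2))"
    using assms by (elim disjE) (simp_all add: numeral_2_eq_2)
qed

end

context double_algebra
begin

lemma bracket_in: "bracket a b \<in> tensor_power 2"
  unfolding bracket_def by (rule D_closed) (simp add: pure_in_tensor_power)

lemma linear_D_comp:
  assumes l: "Vector_Spaces.linear scale fun_scale h" and "\<And>x. h x \<in> tensor_power 2"
  shows "Vector_Spaces.linear scale fun_scale (\<lambda>x. D (h x))"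
proof -
  interpret h: Vector_Spaces.linear scale fun_scale h by (rule l)
  show ?thesis
    by unfold_locales (simp_all add: h.add h.scale D_add D_scale assms(2))
qed

lemma linear_bracket_left: "Vector_Spaces.linear scale fun_scale (\<lambda>a. bracket a b)"
  unfolding bracket_def
proof (rule linear_D_comp)
  show "Vector_Spaces.linear scale fun_scale (\<lambda>x. pure [x, b])"
    using multilinear_pure[of 2, unfolded multilinear_def, rule_format, of "[0, b]" 0] by simp
qed (simp add: pure_in_tensor_power)

lemma linear_bracket_right: "Vector_Spaces.linear scale fun_scale (\<lambda>b. bracket a b)"
  unfolding bracket_def
proof (rule linear_D_comp)
  show "Vector_Spaces.linear scale fun_scale (\<lambda>x. pure [a, x])"
    using multilinear_pure[of 2, unfolded multilinear_def, rule_format, of "[a, 0]" 1] by simp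
qed (simp add: pure_in_tensor_power)

lemma perm01: "transpose 0 1 permutes {..<3::nat}"
  and perm12: "transpose 1 2 permutes {..<3::nat}"
  by (rule permutes_swap_id; simp)+

lemma bracket_right_L_pure:
  "bracket_right_L a (pure [b, c]) = tensor_snoc 2 (bracket a b) c"
proof -
  have "multilinear 3 fun_scale (\<lambda>xs. tensor_snoc 2 (bracket (xs ! 0) (xs ! 1)) (xs ! 2))"
    by (intro multilinear3I linear_tensor_snoc_right bracket_in
        linear_comp[OF linear_bracket_left linear_tensor_snoc]
        linear_comp[OF linear_bracket_right linear_tensor_snoc])
  then show ?thesis
    unfolding bracket_right_L_def ext_right_L_def
    by (simp add: tensor_lift_pure[OF fn.vector_space_axioms])
qed

lemma bracket_right_R_pure:
  "bracket_right_R a (pure [b, c]) =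
     tensor_perm 3 (transpose 0 1) (tensor_cons 2 b (bracket a c))"
proof -
  have "multilinear 3 fun_scale
     (\<lambda>xs. tensor_perm 3 (transpose 0 1) (tensor_cons 2 (xs ! 1) (bracket (xs ! 0) (xs ! 2))))"
    by (intro multilinear3I bracket_in
        linear_comp[OF _ linear_tensor_perm[OF perm01]] linear_tensor_cons_left
        linear_comp[OF linear_bracket_left linear_tensor_cons]
        linear_comp[OF linear_bracket_right linear_tensor_cons])
  then show ?thesis
    unfolding bracket_right_R_def ext_right_R_def
    by (simp add: tensor_lift_pure[OF fn.vector_space_axioms])
qed

lemma bracket_left_L_pure:
  "bracket_left_L (pure [a, b]) c =
     tensor_perm 3 (transpose 1 2) (tensor_snoc 2 (bracket a c) b)"
proof -
  have "multilinear 3 fun_scale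
     (\<lambda>xs. tensor_perm 3 (transpose 1 2) (tensor_snoc 2 (bracket (xs ! 0) (xs ! 2)) (xs ! 1)))"
    by (intro multilinear3I bracket_in
        linear_comp[OF _ linear_tensor_perm[OF perm12]] linear_tensor_snoc_right
        linear_comp[OF linear_bracket_left linear_tensor_snoc]
        linear_comp[OF linear_bracket_right linear_tensor_snoc])
  then show ?thesis
    unfolding bracket_left_L_def ext_left_L_def
    by (simp add: tensor_lift_pure[OF fn.vector_space_axioms])
qed

lemma bracket_left_R_pure:
  "bracket_left_R (pure [a, b]) c = tensor_cons 2 a (bracket b c)"
proof -
  have "multilinear 3 fun_scale (\<lambda>xs. tensor_cons 2 (xs ! 0) (bracket (xs ! 1) (xs ! 2)))"
    by (intro multilinear3I linear_tensor_cons_left bracket_in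
        linear_comp[OF linear_bracket_left linear_tensor_cons]
        linear_comp[OF linear_bracket_right linear_tensor_cons])
  then show ?thesis
    unfolding bracket_left_R_def ext_left_R_def
    by (simp add: tensor_lift_pure[OF fn.vector_space_axioms])
qed

end

end

theory Submission
  imports Defs
begin

text \<open>
  Write the bracket as \<open>r = \<Sum> A\<^sub>i \<otimes> B\<^sub>i\<close> with operators \<open>A\<^sub>i\<close>, \<open>B\<^sub>i\<close> on \<open>V\<close> and as few summands as
  possible, so that the \<open>A\<^sub>i\<close> and the \<open>B\<^sub>i\<close> are linearly independent.  Associativity reads
  \<open>r\<^sub>1\<^sub>2 r\<^sub>2\<^sub>3 = r\<^sub>1\<^sub>3 r\<^sub>1\<^sub>2\<close> and \<open>r\<^sub>1\<^sub>3 r\<^sub>2\<^sub>3 = r\<^sub>2\<^sub>3 r\<^sub>1\<^sub>2\<close>; contracting two tensor factors with functionals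
  \<open>\<alpha>\<^sub>i\<close>, \<open>\<beta>\<^sub>i\<close> dual to \<open>A\<^sub>i\<close>, \<open>B\<^sub>i\<close> shows that \<open>\<B> = span {B\<^sub>i}\<close> is closed under products and that
  \<open>\<B> A\<^sub>i \<subseteq> \<B>\<close>.  A subspace invariant under all \<open>A\<^sub>i\<close> and \<open>B\<^sub>i\<close> is an ideal, so simplicity makes \<open>V\<close> an
  irreducible \<open>\<B>\<close>-module on which only \<open>0\<close> is annihilated by \<open>\<B>\<close>, and a density argument gives
  \<open>1 = \<Sum> c\<^sub>i B\<^sub>i\<close>.  With \<open>\<epsilon> = \<Sum> c\<^sub>i \<alpha>\<^sub>i\<close> the contracted identities become \<open>A\<^sub>q = \<Sum>\<^sub>j \<epsilon>(A\<^sub>q A\<^sub>j) B\<^sub>j\<close> and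
  \<open>\<epsilon>(A\<^sub>j B\<^sub>p) = \<delta>\<^sub>j\<^sub>p\<close>.  Hence \<open>\<epsilon>(A\<^sub>j A\<^sub>q) = \<epsilon>(A\<^sub>q A\<^sub>j)\<close>, and \<open>r = \<Sum> \<epsilon>(A\<^sub>q A\<^sub>j) B\<^sub>j \<otimes> B\<^sub>q\<close> is symmetric.
\<close>

section \<open>Linear functionals: separation and dual families\<close>

lemmas linear_add = module_hom.add[OF module_hom_linearI]
  and linear_scale = module_hom.scale[OF module_hom_linearI]
  and linear_sum = module_hom.sum[OF module_hom_linearI]
  and linear_zero = module_hom.zero[OF module_hom_linearI]
  and linear_diff = module_hom.diff[OF module_hom_linearI]

context vector_space
begin

text \<open>Coefficients are attached to indices rather than to elements of the image, so
  \<open>f\<close> may repeat values.\<close>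

lemma span_image_coefficients:
  assumes "finite I" "w \<in> span (f ` I)"
  obtains c where "w = (\<Sum>i\<in>I. scale (c i) (f i))"
proof -
  have "\<exists>c. w = (\<Sum>i\<in>I. scale (c i) (f i))"
    using assms(2)
  proof (induction rule: span_induct_alt)
    case base
    show ?case by (rule exI[of _ "\<lambda>_. 0"]) simp
  next
    case (step r x y)
    then obtain i c where i: "i \<in> I" "x = f i" and y: "y = (\<Sum>i\<in>I. scale (c i) (f i))" by blast
    have "scale r x = (\<Sum>j\<in>I. scale (if j = i then r else 0) (f j))"
      using i assms(1) by (simp add: if_distrib[of "\<lambda>r. scale r _"] cong: if_cong)
    then have "scale r x + y = (\<Sum>j\<in>I. scale ((if j = i then r else 0) + c j) (f j))"
      unfolding y by (simp only: scale_left_distrib sum.distrib)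
    then show ?case by (intro exI)
  qed
  then show thesis using that by blast
qed

text \<open>A basis of the span of \<open>S\<close> stays independent when \<open>w\<close> is
  added, so the values 1 at \<open>w\<close> and 0 on that basis can be prescribed.\<close>

lemma functional_vanishing_on:
  assumes "w \<notin> span S"
  obtains \<phi> where "Vector_Spaces.linear scale (*) \<phi>" "\<phi> w = 1" "\<And>s. s \<in> S \<Longrightarrow> \<phi> s = 0"
proof -
  interpret K: vector_space "(*) :: 'a \<Rightarrow> 'a \<Rightarrow> 'a" by (rule vector_space_times)
  interpret P: vector_space_pair scale "(*) :: 'a \<Rightarrow> 'a \<Rightarrow> 'a" ..
  obtain B where B: "B \<subseteq> S" "independent B" "S \<subseteq> span B"
    using maximal_independent_subset[of S] by blast
  have "w \<notin> span B" using assms span_mono[OF B(1)] by blast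
  then have ind: "independent (insert w B)" using B(2) by (rule independent_insertI)
  have "w \<notin> B" using \<open>w \<notin> span B\<close> span_base by blast
  define \<phi> where "\<phi> = P.construct (insert w B) (\<lambda>b. if b = w then 1 else 0)"
  have lin: "Vector_Spaces.linear scale (*) \<phi>"
    unfolding \<phi>_def by (rule P.linear_construct[OF ind])
  have "\<phi> b = 0" if "b \<in> B" for b
    unfolding \<phi>_def using that \<open>w \<notin> B\<close> by (subst P.construct_basis[OF ind]) auto
  then have "\<phi> s = 0" if "s \<in> S" for s
    using P.linear_eq_0_on_span[OF lin, of B s] B(3) that by blast
  moreover have "\<phi> w = 1" unfolding \<phi>_def by (subst P.construct_basis[OF ind]) auto
  ultimately show thesis using that lin by blast
qed

text \<open>Independence is stated for the indexed family, the form in which minimality of a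
  decomposition supplies it.\<close>

lemma dual_functionals:
  assumes indep: "\<And>i. i \<in> I \<Longrightarrow> f i \<notin> span (f ` (I - {i}))"
  obtains \<alpha> where "\<And>i. i \<in> I \<Longrightarrow> Vector_Spaces.linear scale (*) (\<alpha> i)"
    "\<And>i j. i \<in> I \<Longrightarrow> j \<in> I \<Longrightarrow> \<alpha> i (f j) = (if i = j then 1 else 0)"
proof -
  have "\<exists>\<phi>. Vector_Spaces.linear scale (*) \<phi> \<and> (\<forall>j\<in>I. \<phi> (f j) = (if i = j then 1 else 0))"
    if i: "i \<in> I" for i
  proof -
    obtain \<phi> where "Vector_Spaces.linear scale (*) \<phi>" "\<phi> (f i) = 1"
      "\<And>s. s \<in> f ` (I - {i}) \<Longrightarrow> \<phi> s = 0"
      using functional_vanishing_on[OF indep[OF i]] by blast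
    then show ?thesis by (intro exI[of _ \<phi>]) auto
  qed
  then show thesis using that by metis
qed

text \<open>Turns the scalar identities left after contraction back into identities between
  vectors.\<close>

lemma functionals_separate:
  assumes "\<And>\<phi>. Vector_Spaces.linear scale (*) \<phi> \<Longrightarrow> \<phi> v = \<phi> w"
  shows "v = w"
proof (rule ccontr)
  assume "v \<noteq> w"
  then obtain \<phi> where "Vector_Spaces.linear scale (*) \<phi>" "\<phi> (v - w) = 1"
    using functional_separates[OF vector_space_axioms, of "v - w"] by auto
  then show False using assms[of \<phi>] by (simp add: linear_diff)
qed

end

lemma sum_fun_apply: "(\<Sum>i\<in>I. f i) x = (\<Sum>i\<in>I. f i x)"
  for f :: "'i \<Rightarrow> 'x \<Rightarrow> 'y::comm_monoid_add"
  by (induction I rule: infinite_finite_induct) auto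

section \<open>Operators on V and contraction of tensor identities\<close>

context tensor_powers
begin

definition op_scale :: "'k \<Rightarrow> ('v \<Rightarrow> 'v) \<Rightarrow> 'v \<Rightarrow> 'v" where
  "op_scale c T = (\<lambda>x. scale c (T x))"

sublocale op: vector_space op_scale
  by unfold_locales (auto simp: op_scale_def fun_eq_iff scale_right_distrib scale_left_distrib)

text \<open>A slot contracted with this functional keeps its vector at one argument under an
  arbitrary \<open>f\<close>, which \<open>functionals_separate\<close> can strip off
  afterwards.\<close>

lemma linear_evaluation:
  assumes "Vector_Spaces.linear scale (*) f"
  shows "Vector_Spaces.linear op_scale (*) (\<lambda>T :: 'v \<Rightarrow> 'v. f (T x))"
  using linear_add[OF assms] linear_scale[OF assms]
  by (auto simp: Vector_Spaces.linear_iff op.vector_space_axioms vector_space_times op_scale_def)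

text \<open>The functionals \<open>T \<mapsto> f (T x)\<close> separate operators. Agreement on all
  of them makes the two weighted operator sums equal, and then any functional \<open>F\<close> can
  be applied, whether or not it comes from evaluations.\<close>

lemma op_sum_eqI:
  fixes P :: "'i \<Rightarrow> 'v \<Rightarrow> 'v" and P' :: "'j \<Rightarrow> 'v \<Rightarrow> 'v"
  assumes eq: "\<And>f x. Vector_Spaces.linear scale (*) f \<Longrightarrow>
      (\<Sum>i\<in>I. f (P i x) * c i) = (\<Sum>j\<in>J. f (P' j x) * d j)"
    and F: "Vector_Spaces.linear op_scale (*) F"
  shows "(\<Sum>i\<in>I. F (P i) * c i) = (\<Sum>j\<in>J. F (P' j) * d j)"
proof -
  have "(\<Sum>i\<in>I. op_scale (c i) (P i)) = (\<Sum>j\<in>J. op_scale (d j) (P' j))"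
  proof
    fix x
    show "(\<Sum>i\<in>I. op_scale (c i) (P i)) x = (\<Sum>j\<in>J. op_scale (d j) (P' j)) x"
    proof (rule functionals_separate)
      fix f assume f: "Vector_Spaces.linear scale (*) f"
      show "f ((\<Sum>i\<in>I. op_scale (c i) (P i)) x) = f ((\<Sum>j\<in>J. op_scale (d j) (P' j)) x)"
        using eq[OF f, of x]
        by (simp add: sum_fun_apply op_scale_def linear_sum[OF f] linear_scale[OF f] mult.commute)
    qed
  qed
  from arg_cong[OF this, of F] show ?thesis
    by (simp add: linear_sum[OF F] linear_scale[OF F] mult.commute)
qed

text \<open>A tensor is itself a functional on forms, so a tensor identity can be tested at the
  trilinear form given by three linear functionals.\<close>

lemma pure_functional_product:
  assumes "Vector_Spaces.linear scale (*) f" "Vector_Spaces.linear scale (*) g"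
    "Vector_Spaces.linear scale (*) h"
  shows "pure [x, y, z] (\<lambda>xs. f (xs ! 0) * (g (xs ! 1) * h (xs ! 2))) = f x * (g y * h z)"
proof -
  have "multilinear 3 (*) (\<lambda>xs. f (xs ! 0) * (g (xs ! 1) * h (xs ! 2)))"
    by (rule multilinear3I)
      (use assms in \<open>auto simp: Vector_Spaces.linear_iff algebra_simps\<close>)
  then show ?thesis by (simp add: pure_def numeral_3_eq_3)
qed

text \<open>The tensor identity is first evaluated at products of functionals on V. Then
  \<open>op_sum_eqI\<close> upgrades one slot at a time from evaluations to an arbitrary functional
  on operators, the other two slots serving as coefficients. Upper case in \<open>Fgh\<close> and
  \<open>FGh\<close> marks the slots already upgraded.\<close>

lemma pure3_sum_contract:
  fixes P Q S :: "'i \<Rightarrow> 'v \<Rightarrow> 'v" and P' Q' S' :: "'j \<Rightarrow> 'v \<Rightarrow> 'v"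
  assumes eq: "\<And>x y z. (\<Sum>i\<in>I. pure [P i x, Q i y, S i z]) = (\<Sum>j\<in>J. pure [P' j x, Q' j y, S' j z])"
    and F: "Vector_Spaces.linear op_scale (*) F" and G: "Vector_Spaces.linear op_scale (*) G"
    and H: "Vector_Spaces.linear op_scale (*) H"
  shows "(\<Sum>i\<in>I. F (P i) * (G (Q i) * H (S i))) = (\<Sum>j\<in>J. F (P' j) * (G (Q' j) * H (S' j)))"
proof -
  have fgh: "(\<Sum>i\<in>I. f (P i x) * (g (Q i y) * h (S i z))) =
      (\<Sum>j\<in>J. f (P' j x) * (g (Q' j y) * h (S' j z)))"
    if "Vector_Spaces.linear scale (*) f" "Vector_Spaces.linear scale (*) g"
      "Vector_Spaces.linear scale (*) h" for f g h x y z
    using arg_cong[OF eq[of x y z], of "\<lambda>t. t (\<lambda>xs. f (xs ! 0) * (g (xs ! 1) * h (xs ! 2)))"]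
    by (simp only: sum_fun_apply pure_functional_product[OF that])
  have Fgh: "(\<Sum>i\<in>I. g (Q i y) * (F (P i) * h (S i z))) =
      (\<Sum>j\<in>J. g (Q' j y) * (F (P' j) * h (S' j z)))"
    if "Vector_Spaces.linear scale (*) g" "Vector_Spaces.linear scale (*) h" for g h y z
  proof -
    have "(\<Sum>i\<in>I. F (P i) * (g (Q i y) * h (S i z))) =
        (\<Sum>j\<in>J. F (P' j) * (g (Q' j y) * h (S' j z)))"
      by (rule op_sum_eqI[OF _ F]) (rule fgh[OF _ that])
    then show ?thesis by (simp only: ac_simps)
  qed
  have FGh: "(\<Sum>i\<in>I. h (S i z) * (F (P i) * G (Q i))) =
      (\<Sum>j\<in>J. h (S' j z) * (F (P' j) * G (Q' j)))"
    if "Vector_Spaces.linear scale (*) h" for h z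
  proof -
    have "(\<Sum>i\<in>I. G (Q i) * (F (P i) * h (S i z))) =
        (\<Sum>j\<in>J. G (Q' j) * (F (P' j) * h (S' j z)))"
      by (rule op_sum_eqI[OF _ G]) (rule Fgh[OF _ that])
    then show ?thesis by (simp only: ac_simps)
  qed
  have "(\<Sum>i\<in>I. H (S i) * (F (P i) * G (Q i))) = (\<Sum>j\<in>J. H (S' j) * (F (P' j) * G (Q' j)))"
    by (rule op_sum_eqI[OF _ H]) (rule FGh)
  then show ?thesis by (simp only: ac_simps)
qed

lemma linear_pure_left: "Vector_Spaces.linear scale fun_scale (\<lambda>x. pure [x, y])"
  using multilinear_pure[of 2, unfolded multilinear_def, rule_format, of "[0, y]" 0] by simp

lemma linear_pure_right: "Vector_Spaces.linear scale fun_scale (\<lambda>y. pure [x, y])"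
  using multilinear_pure[of 2, unfolded multilinear_def, rule_format, of "[x, 0]" 1] by simp

lemmas pure2_add = linear_add[OF linear_pure_left] linear_add[OF linear_pure_right]
  and pure2_scale = linear_scale[OF linear_pure_left] linear_scale[OF linear_pure_right]
  and pure2_sum = linear_sum[OF linear_pure_left] linear_sum[OF linear_pure_right]

subsection \<open>Minimal decompositions of a bilinear map\<close>

text \<open>The summands form a list, so adding two such maps is concatenation.\<close>

definition finite_rank :: "('v \<Rightarrow> 'v \<Rightarrow> ('v, 'k) tensor) \<Rightarrow> bool" where
  "finite_rank \<phi> \<longleftrightarrow> (\<exists>L. (\<forall>(A, B) \<in> set L. Vector_Spaces.linear scale scale A \<and>
     Vector_Spaces.linear scale scale B) \<and> \<phi> = (\<lambda>x y. \<Sum>(A, B)\<leftarrow>L. pure [A x, B y]))"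

lemma finite_rank_zero: "finite_rank (\<lambda>x y. 0)"
  unfolding finite_rank_def by (rule exI[of _ "[]"]) simp

lemma finite_rank_add:
  assumes "finite_rank \<phi>" "finite_rank \<psi>"
  shows "finite_rank (\<lambda>x y. \<phi> x y + \<psi> x y)"
proof -
  obtain L M where L: "\<forall>(A, B) \<in> set L. Vector_Spaces.linear scale scale A \<and>
       Vector_Spaces.linear scale scale B" "\<phi> = (\<lambda>x y. \<Sum>(A, B)\<leftarrow>L. pure [A x, B y])"
    and M: "\<forall>(A, B) \<in> set M. Vector_Spaces.linear scale scale A \<and>
       Vector_Spaces.linear scale scale B" "\<psi> = (\<lambda>x y. \<Sum>(A, B)\<leftarrow>M. pure [A x, B y])"
    using assms unfolding finite_rank_def by blast
  show ?thesis
    unfolding finite_rank_def by (rule exI[of _ "L @ M"]) (use L M in auto)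
qed

lemma finite_rank_sum:
  assumes "\<And>i. i \<in> I \<Longrightarrow> finite_rank (\<phi> i)"
  shows "finite_rank (\<lambda>x y. \<Sum>i\<in>I. \<phi> i x y)"
  using assms
  by (induction I rule: infinite_finite_induct) (simp_all add: finite_rank_zero finite_rank_add)

lemma finite_rank_pure:
  assumes "Vector_Spaces.linear scale scale A" "Vector_Spaces.linear scale scale B"
  shows "finite_rank (\<lambda>x y. pure [A x, B y])"
  unfolding finite_rank_def by (rule exI[of _ "[(A, B)]"]) (use assms in simp)

lemma linear_scale_vector:
  assumes "Vector_Spaces.linear scale (*) f"
  shows "Vector_Spaces.linear scale scale (\<lambda>x. scale (f x) u)"
  using assms by (simp add: Vector_Spaces.linear_iff scale_left_distrib)

text \<open>For \<open>t = pure [u, v]\<close> this is a single summand with operators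
  \<open>x \<mapsto> f(x) u\<close> and \<open>y \<mapsto> g(y) v\<close>; a general
  \<open>t\<close> is a combination of such tensors.\<close>

lemma finite_rank_functionals:
  assumes f: "Vector_Spaces.linear scale (*) f" and g: "Vector_Spaces.linear scale (*) g"
    and t: "t \<in> tensor_power 2"
  shows "finite_rank (\<lambda>x y. fun_scale (f x * g y) t)"
  using t unfolding tensor_power_def
proof (induction rule: fn.span_induct_alt)
  case base
  show ?case by (simp only: fn.scale_zero_right finite_rank_zero)
next
  case (step c t t')
  then obtain u v where t: "t = pure [u, v]"
    by (auto simp: numeral_2_eq_2 length_Suc_conv)
  have "finite_rank (\<lambda>x y. pure [scale (f x) (scale c u), scale (g y) v])"
    by (intro finite_rank_pure linear_scale_vector f g)
  then have "finite_rank (\<lambda>x y. fun_scale (f x * g y) (fun_scale c t))"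
    unfolding t by (simp add: pure2_scale mult_ac)
  from finite_rank_add[OF this step(2)] show ?case
    by (simp only: fn.scale_right_distrib)
qed

text \<open>Both arguments are expanded in a finite basis. The coordinates are linear functionals,
  so every term of the double sum falls under \<open>finite_rank_functionals\<close>.\<close>

lemma finite_rank_bilinear:
  assumes E: "finite E" "span E = UNIV"
    and left: "\<And>y. Vector_Spaces.linear scale fun_scale (\<lambda>x. \<phi> x y)"
    and right: "\<And>x. Vector_Spaces.linear scale fun_scale (\<phi> x)"
    and closed: "\<And>x y. \<phi> x y \<in> tensor_power 2"
  shows "finite_rank \<phi>"
proof -
  obtain B where B: "B \<subseteq> E" "independent B" "E \<subseteq> span B"
    using maximal_independent_subset[of E] by blast
  have fin: "finite B" using B(1) E(1) by (rule finite_subset)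
  have span: "span B = UNIV" using span_minimal[OF B(3) subspace_span] E(2) by blast
  define r where "r = representation B"
  have lin: "Vector_Spaces.linear scale (*) (\<lambda>x. r x b)" for b
    using B(2) span
    by (simp add: Vector_Spaces.linear_iff vector_space_axioms vector_space_times r_def
        representation_add representation_scale)
  have expand: "x = (\<Sum>b\<in>B. scale (r x b) b)" for x
    unfolding r_def using sum_representation_eq[OF B(2), of x B] fin span by simp
  have expansion: "\<phi> x y = (\<Sum>b\<in>B. \<Sum>b'\<in>B. fun_scale (r x b * r y b') (\<phi> b b'))" for x y
  proof -
    have "\<phi> x y = (\<Sum>b\<in>B. fun_scale (r x b) (\<phi> b y))"
      by (subst expand[of x]) (simp only: linear_sum[OF left] linear_scale[OF left])
    also have "\<dots> = (\<Sum>b\<in>B. fun_scale (r x b) (\<Sum>b'\<in>B. fun_scale (r y b') (\<phi> b b')))"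
    proof (rule sum.cong)
      fix b
      have "\<phi> b y = (\<Sum>b'\<in>B. fun_scale (r y b') (\<phi> b b'))"
        by (subst expand[of y]) (simp only: linear_sum[OF right] linear_scale[OF right])
      then show "fun_scale (r x b) (\<phi> b y) =
          fun_scale (r x b) (\<Sum>b'\<in>B. fun_scale (r y b') (\<phi> b b'))" by (rule arg_cong)
    qed simp
    finally show ?thesis by (simp only: fn.scale_sum_right fn.scale_scale)
  qed
  have "(\<lambda>x y. \<Sum>b\<in>B. \<Sum>b'\<in>B. fun_scale (r x b * r y b') (\<phi> b b')) = \<phi>"
    by (rule ext, rule ext, rule expansion[symmetric])
  moreover have "finite_rank (\<lambda>x y. \<Sum>b\<in>B. \<Sum>b'\<in>B. fun_scale (r x b * r y b') (\<phi> b b'))"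
    by (intro finite_rank_sum finite_rank_functionals lin closed)
  ultimately show ?thesis by (simp only:)
qed

text \<open>Any finite index set is allowed, so an index can be deleted without renumbering.\<close>

definition decomposition ::
    "('v \<Rightarrow> 'v \<Rightarrow> ('v, 'k) tensor) \<Rightarrow> nat set \<Rightarrow> (nat \<Rightarrow> 'v \<Rightarrow> 'v) \<Rightarrow> (nat \<Rightarrow> 'v \<Rightarrow> 'v) \<Rightarrow> bool" where
  "decomposition \<phi> I A B \<longleftrightarrow> finite I \<and>
     (\<forall>i\<in>I. Vector_Spaces.linear scale scale (A i) \<and> Vector_Spaces.linear scale scale (B i)) \<and>
     (\<forall>x y. \<phi> x y = (\<Sum>i\<in>I. pure [A i x, B i y]))"

lemma finite_rank_decomposition:
  assumes "finite_rank \<phi>"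
  obtains I A B where "decomposition \<phi> I A B"
proof -
  obtain L where L: "\<forall>(A, B) \<in> set L. Vector_Spaces.linear scale scale A \<and>
       Vector_Spaces.linear scale scale B" and \<phi>: "\<phi> = (\<lambda>x y. \<Sum>(A, B)\<leftarrow>L. pure [A x, B y])"
    using assms unfolding finite_rank_def by blast
  have "decomposition \<phi> {0..<length L} (\<lambda>i. fst (L ! i)) (\<lambda>i. snd (L ! i))"
    unfolding decomposition_def
  proof (intro conjI ballI allI)
    fix i assume "i \<in> {0..<length L}"
    then have "L ! i \<in> set L" by simp
    then show "Vector_Spaces.linear scale scale (fst (L ! i))"
      "Vector_Spaces.linear scale scale (snd (L ! i))"
      using L by fastforce+
  qed (simp_all add: \<phi> sum_list_sum_nth case_prod_unfold)
  then show thesis by (rule that)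
qed

text \<open>The summand \<open>A\<^sub>p \<otimes> B\<^sub>p\<close> is distributed over the others:
  a relation \<open>A\<^sub>p = \<Sum> c\<^sub>i A\<^sub>i\<close> lets
  \<open>B\<^sub>i + c\<^sub>i B\<^sub>p\<close> replace \<open>B\<^sub>i\<close>.\<close>

lemma decomposition_reduce_left:
  assumes dec: "decomposition \<phi> I A B" and p: "p \<in> I" "A p \<in> op.span (A ` (I - {p}))"
  shows "\<exists>B'. decomposition \<phi> (I - {p}) A B'"
proof -
  have fin: "finite I" using dec by (simp add: decomposition_def)
  obtain c where c: "A p = (\<Sum>i\<in>I - {p}. op_scale (c i) (A i))"
    using op.span_image_coefficients[OF _ p(2)] fin by blast
  have "\<phi> x y = (\<Sum>i\<in>I - {p}. pure [A i x, B i y + scale (c i) (B p y)])" for x y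
  proof -
    have "\<phi> x y = pure [A p x, B p y] + (\<Sum>i\<in>I - {p}. pure [A i x, B i y])"
      using dec p(1) fin by (simp add: decomposition_def sum.remove[of I p])
    also have "pure [A p x, B p y] = (\<Sum>i\<in>I - {p}. pure [A i x, scale (c i) (B p y)])"
      unfolding c by (simp add: sum_fun_apply op_scale_def pure2_sum pure2_scale)
    finally show ?thesis by (simp only: pure2_add sum.distrib add.commute)
  qed
  moreover have "Vector_Spaces.linear scale scale (\<lambda>y. B i y + scale (c i) (B p y))" if "i \<in> I" for i
    using dec p(1) that
    by (auto simp: decomposition_def Vector_Spaces.linear_iff scale_right_distrib ac_simps)
  ultimately have "decomposition \<phi> (I - {p}) A (\<lambda>i y. B i y + scale (c i) (B p y))"
    using dec by (simp add: decomposition_def)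
  then show ?thesis by blast
qed

lemma decomposition_reduce_right:
  assumes dec: "decomposition \<phi> I A B" and p: "p \<in> I" "B p \<in> op.span (B ` (I - {p}))"
  shows "\<exists>A'. decomposition \<phi> (I - {p}) A' B"
proof -
  have fin: "finite I" using dec by (simp add: decomposition_def)
  obtain c where c: "B p = (\<Sum>i\<in>I - {p}. op_scale (c i) (B i))"
    using op.span_image_coefficients[OF _ p(2)] fin by blast
  have "\<phi> x y = (\<Sum>i\<in>I - {p}. pure [A i x + scale (c i) (A p x), B i y])" for x y
  proof -
    have "\<phi> x y = pure [A p x, B p y] + (\<Sum>i\<in>I - {p}. pure [A i x, B i y])"
      using dec p(1) fin by (simp add: decomposition_def sum.remove[of I p])
    also have "pure [A p x, B p y] = (\<Sum>i\<in>I - {p}. pure [scale (c i) (A p x), B i y])"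
      unfolding c by (simp add: sum_fun_apply op_scale_def pure2_sum pure2_scale)
    finally show ?thesis by (simp only: pure2_add sum.distrib add.commute)
  qed
  moreover have "Vector_Spaces.linear scale scale (\<lambda>x. A i x + scale (c i) (A p x))" if "i \<in> I" for i
    using dec p(1) that
    by (auto simp: decomposition_def Vector_Spaces.linear_iff scale_right_distrib ac_simps)
  ultimately have "decomposition \<phi> (I - {p}) (\<lambda>i x. A i x + scale (c i) (A p x)) B"
    using dec by (simp add: decomposition_def)
  then show ?thesis by blast
qed

text \<open>A linear relation in either family would save a summand, so a decomposition with least
  \<open>card I\<close> has both families independent.\<close>

lemma minimal_decomposition:
  assumes "finite_rank \<phi>"
  obtains I A B where "decomposition \<phi> I A B"
    "\<And>i. i \<in> I \<Longrightarrow> A i \<notin> op.span (A ` (I - {i}))"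
    "\<And>i. i \<in> I \<Longrightarrow> B i \<notin> op.span (B ` (I - {i}))"
proof -
  define P where "P = (\<lambda>n. \<exists>I A B. decomposition \<phi> I A B \<and> card I = n)"
  have "\<exists>n. P n" unfolding P_def using finite_rank_decomposition[OF assms] by metis
  then obtain n where n: "P n" "\<And>m. P m \<Longrightarrow> n \<le> m"
    by (metis LeastI_ex Least_le)
  then obtain I A B where dec: "decomposition \<phi> I A B" "card I = n" unfolding P_def by blast
  have smaller: "\<not> decomposition \<phi> (I - {i}) A' B'" if "i \<in> I" for i A' B'
  proof
    assume "decomposition \<phi> (I - {i}) A' B'"
    then have "n \<le> card (I - {i})" by (intro n(2)) (auto simp: P_def)
    moreover have "card (I - {i}) < card I"
      using dec(1) that by (intro card_Diff1_less) (simp_all add: decomposition_def)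
    ultimately show False using dec(2) by simp
  qed
  show thesis
  proof (rule that[OF dec(1)])
    show "A i \<notin> op.span (A ` (I - {i}))" if "i \<in> I" for i
      using decomposition_reduce_left[OF dec(1) that] smaller[OF that] by blast
    show "B i \<notin> op.span (B ` (I - {i}))" if "i \<in> I" for i
      using decomposition_reduce_right[OF dec(1) that] smaller[OF that] by blast
  qed
qed

end

section \<open>Linearity of the extended brackets\<close>

context double_algebra
begin

lemma tensor_perm_12: "tensor_perm 3 (transpose 1 2) (pure [x, y, z]) = pure [x, z, y]"
  by (simp add: tensor_perm_pure[OF perm12, simplified] permute_list_def transpose_def)

lemma tensor_perm_01: "tensor_perm 3 (transpose 0 1) (pure [x, y, z]) = pure [y, x, z]"
  by (simp add: tensor_perm_pure[OF perm01, simplified] permute_list_def transpose_def)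

lemma linear_bracket_right_L: "Vector_Spaces.linear fun_scale fun_scale (bracket_right_L a)"
proof -
  have "multilinear 3 fun_scale (\<lambda>xs. tensor_snoc 2 (bracket (xs ! 0) (xs ! 1)) (xs ! 2))"
    by (intro multilinear3I linear_tensor_snoc_right bracket_in
        linear_comp[OF linear_bracket_left linear_tensor_snoc]
        linear_comp[OF linear_bracket_right linear_tensor_snoc])
  from linear_comp[OF linear_tensor_cons tensor_lift_linear[OF fn.vector_space_axioms this]]
  show ?thesis unfolding bracket_right_L_def[abs_def] ext_right_L_def .
qed

lemma linear_bracket_right_R: "Vector_Spaces.linear fun_scale fun_scale (bracket_right_R a)"
proof -
  have "multilinear 3 fun_scale
     (\<lambda>xs. tensor_perm 3 (transpose 0 1) (tensor_cons 2 (xs ! 1) (bracket (xs ! 0) (xs ! 2))))"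
    by (intro multilinear3I bracket_in
        linear_comp[OF _ linear_tensor_perm[OF perm01]] linear_tensor_cons_left
        linear_comp[OF linear_bracket_left linear_tensor_cons]
        linear_comp[OF linear_bracket_right linear_tensor_cons])
  from linear_comp[OF linear_tensor_cons tensor_lift_linear[OF fn.vector_space_axioms this]]
  show ?thesis unfolding bracket_right_R_def[abs_def] ext_right_R_def .
qed

lemma linear_bracket_left_L:
  "Vector_Spaces.linear fun_scale fun_scale (\<lambda>u. bracket_left_L u c)"
proof -
  have "multilinear 3 fun_scale
     (\<lambda>xs. tensor_perm 3 (transpose 1 2) (tensor_snoc 2 (bracket (xs ! 0) (xs ! 2)) (xs ! 1)))"
    by (intro multilinear3I bracket_in
        linear_comp[OF _ linear_tensor_perm[OF perm12]] linear_tensor_snoc_right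
        linear_comp[OF linear_bracket_left linear_tensor_snoc]
        linear_comp[OF linear_bracket_right linear_tensor_snoc])
  from linear_comp[OF linear_tensor_snoc tensor_lift_linear[OF fn.vector_space_axioms this]]
  show ?thesis unfolding bracket_left_L_def ext_left_L_def .
qed

lemma linear_bracket_left_R:
  "Vector_Spaces.linear fun_scale fun_scale (\<lambda>u. bracket_left_R u c)"
proof -
  have "multilinear 3 fun_scale (\<lambda>xs. tensor_cons 2 (xs ! 0) (bracket (xs ! 1) (xs ! 2)))"
    by (intro multilinear3I linear_tensor_cons_left bracket_in
        linear_comp[OF linear_bracket_left linear_tensor_cons]
        linear_comp[OF linear_bracket_right linear_tensor_cons])
  from linear_comp[OF linear_tensor_snoc tensor_lift_linear[OF fn.vector_space_axioms this]]
  show ?thesis unfolding bracket_left_R_def ext_left_R_def .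
qed

end

subsection \<open>Associativity contracted with dual functionals\<close>

text \<open>The dual functionals encode independence of the two families. They are defined on all
  operators and so apply also to products such as \<open>A\<^sub>q A\<^sub>j\<close>.\<close>

locale dual_decomposition = double_algebra scale D
  for scale :: "'k::field \<Rightarrow> 'v::ab_group_add \<Rightarrow> 'v" and D +
  fixes I :: "nat set" and A B :: "nat \<Rightarrow> 'v \<Rightarrow> 'v"
    and \<alpha> \<beta> :: "nat \<Rightarrow> ('v \<Rightarrow> 'v) \<Rightarrow> 'k"
  assumes decomposition: "decomposition bracket I A B"
    and linear_alpha: "i \<in> I \<Longrightarrow> Vector_Spaces.linear op_scale (*) (\<alpha> i)"
    and alpha_A: "i \<in> I \<Longrightarrow> j \<in> I \<Longrightarrow> \<alpha> i (A j) = (if i = j then 1 else 0)"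
    and linear_beta: "i \<in> I \<Longrightarrow> Vector_Spaces.linear op_scale (*) (\<beta> i)"
    and beta_B: "i \<in> I \<Longrightarrow> j \<in> I \<Longrightarrow> \<beta> i (B j) = (if i = j then 1 else 0)"
    and assoc: associative
    and simple: simple
begin

lemma finite_I: "finite I"
  and linear_A: "i \<in> I \<Longrightarrow> Vector_Spaces.linear scale scale (A i)"
  and linear_B: "i \<in> I \<Longrightarrow> Vector_Spaces.linear scale scale (B i)"
  and bracket_eq: "bracket x y = (\<Sum>i\<in>I. pure [A i x, B i y])"
  using decomposition by (simp_all add: decomposition_def)

text \<open>\<open>pure3_sum_contract\<close> has one summation index, so double sums are taken over
  pairs.\<close>

lemma sum_pairs: "(\<Sum>k\<in>I \<times> I. f (fst k) (snd k)) = (\<Sum>i\<in>I. \<Sum>j\<in>I. f i j)"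
  for f :: "nat \<Rightarrow> nat \<Rightarrow> 'w::comm_monoid_add"
  by (simp add: sum.cartesian_product case_prod_unfold)

text \<open>Expanding the inner bracket and then the outer one in the first associativity law gives
  \<open>r\<^sub>1\<^sub>2 r\<^sub>2\<^sub>3 = r\<^sub>1\<^sub>3 r\<^sub>1\<^sub>2\<close>.\<close>

lemma assoc_L:
  "(\<Sum>k\<in>I \<times> I. pure [A (fst k) x, B (fst k) (A (snd k) y), B (snd k) z]) =
   (\<Sum>k\<in>I \<times> I. pure [A (fst k) (A (snd k) x), B (snd k) y, B (fst k) z])"
proof -
  have "bracket_right_L x (bracket y z) =
      (\<Sum>j\<in>I. \<Sum>i\<in>I. pure [A i x, B i (A j y), B j z])"
    by (simp add: bracket_eq[of y z] linear_sum[OF linear_bracket_right_L] bracket_right_L_pure)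
      (simp add: bracket_eq linear_sum[OF linear_tensor_snoc])
  moreover have "bracket_left_L (bracket x y) z =
      (\<Sum>j\<in>I. \<Sum>i\<in>I. pure [A i (A j x), B j y, B i z])"
    by (simp add: bracket_eq[of x y] linear_sum[OF linear_bracket_left_L] bracket_left_L_pure del: One_nat_def)
      (simp add: bracket_eq linear_sum[OF linear_tensor_snoc] linear_sum[OF linear_tensor_perm[OF perm12]]
        tensor_perm_12 del: One_nat_def)
  moreover have "bracket_right_L x (bracket y z) = bracket_left_L (bracket x y) z"
    using assoc unfolding associative_def by blast
  ultimately have "(\<Sum>j\<in>I. \<Sum>i\<in>I. pure [A i x, B i (A j y), B j z]) =
      (\<Sum>j\<in>I. \<Sum>i\<in>I. pure [A i (A j x), B j y, B i z])"
    by (simp only:)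
  from sum.swap[of "\<lambda>i j. pure [A i x, B i (A j y), B j z]" I I, unfolded this]
    sum.swap[of "\<lambda>i j. pure [A i (A j x), B j y, B i z]" I I]
  show ?thesis
    unfolding sum_pairs[of "\<lambda>i j. pure [A i x, B i (A j y), B j z]"]
      sum_pairs[of "\<lambda>i j. pure [A i (A j x), B j y, B i z]"]
    by (rule trans[OF _ sym])
qed

text \<open>The same expansion of the second law gives \<open>r\<^sub>1\<^sub>3 r\<^sub>2\<^sub>3 =
  r\<^sub>2\<^sub>3 r\<^sub>1\<^sub>2\<close>.\<close>

lemma assoc_R:
  "(\<Sum>k\<in>I \<times> I. pure [A (fst k) x, A (snd k) y, B (fst k) (B (snd k) z)]) =
   (\<Sum>k\<in>I \<times> I. pure [A (fst k) x, A (snd k) (B (fst k) y), B (snd k) z])"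
proof -
  have "bracket_right_R x (bracket y z) =
      (\<Sum>j\<in>I. \<Sum>i\<in>I. pure [A i x, A j y, B i (B j z)])"
    by (simp add: bracket_eq[of y z] linear_sum[OF linear_bracket_right_R] bracket_right_R_pure del: One_nat_def)
      (simp add: bracket_eq linear_sum[OF linear_tensor_cons] linear_sum[OF linear_tensor_perm[OF perm01]]
        tensor_perm_01 del: One_nat_def)
  moreover have "bracket_left_R (bracket x y) z =
      (\<Sum>i\<in>I. \<Sum>j\<in>I. pure [A i x, A j (B i y), B j z])"
    by (simp add: bracket_eq[of x y] linear_sum[OF linear_bracket_left_R] bracket_left_R_pure)
      (simp add: bracket_eq linear_sum[OF linear_tensor_cons])
  moreover have "bracket_right_R x (bracket y z) = bracket_left_R (bracket x y) z"
    using assoc unfolding associative_def by blast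
  ultimately have "(\<Sum>j\<in>I. \<Sum>i\<in>I. pure [A i x, A j y, B i (B j z)]) =
      (\<Sum>i\<in>I. \<Sum>j\<in>I. pure [A i x, A j (B i y), B j z])"
    by (simp only:)
  from sum.swap[of "\<lambda>i j. pure [A i x, A j y, B i (B j z)]" I I, unfolded this]
  show ?thesis
    unfolding sum_pairs[of "\<lambda>i j. pure [A i x, A j y, B i (B j z)]"]
      sum_pairs[of "\<lambda>i j. pure [A i x, A j (B i y), B j z]"] .
qed

lemma sum_alpha_A:
  assumes "p \<in> I"
  shows "(\<Sum>i\<in>I. \<alpha> p (A i) * h i) = h p"
proof -
  have "(\<Sum>i\<in>I. \<alpha> p (A i) * h i) = (\<Sum>i\<in>I. if p = i then h i else 0)"
    using assms by (intro sum.cong) (auto simp: alpha_A)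
  then show ?thesis using assms finite_I by simp
qed

lemma sum_beta_B:
  assumes "q \<in> I"
  shows "(\<Sum>i\<in>I. h i * \<beta> q (B i)) = h q"
proof -
  have "(\<Sum>i\<in>I. h i * \<beta> q (B i)) = (\<Sum>i\<in>I. if q = i then h i else 0)"
    using assms by (intro sum.cong) (auto simp: beta_B)
  then show ?thesis using assms finite_I by simp
qed

text \<open>Contract slots one and three of \<open>assoc_L\<close> with \<open>\<alpha> p\<close>
  and \<open>\<beta> q\<close>. On the left only \<open>i = p\<close>, \<open>j = q\<close>
  survives; on the right \<open>\<beta> q\<close> forces \<open>i = q\<close>. So composing with
  \<open>A q\<close> on the right sends each \<open>B p\<close> into the span of the
  \<open>B j\<close>.\<close>

lemma B_A:
  assumes p: "p \<in> I" and q: "q \<in> I"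
  shows "B p (A q y) = (\<Sum>j\<in>I. scale (\<alpha> p (\<lambda>x. A q (A j x))) (B j y))"
proof (rule functionals_separate)
  fix f assume f: "Vector_Spaces.linear scale (*) f"
  have "(\<Sum>i\<in>I. \<Sum>j\<in>I. \<alpha> p (A i) * (f (B i (A j y)) * \<beta> q (B j))) =
      (\<Sum>i\<in>I. \<Sum>j\<in>I. \<alpha> p (\<lambda>x. A i (A j x)) * (f (B j y) * \<beta> q (B i)))"
    using pure3_sum_contract[where P = "\<lambda>k. A (fst k)" and Q = "\<lambda>k y. B (fst k) (A (snd k) y)"
        and S = "\<lambda>k. B (snd k)" and P' = "\<lambda>k x. A (fst k) (A (snd k) x)"
        and Q' = "\<lambda>k. B (snd k)" and S' = "\<lambda>k. B (fst k)",
        OF assoc_L linear_alpha[OF p] linear_evaluation[OF f, of y] linear_beta[OF q]]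
    unfolding sum_pairs[of "\<lambda>i j. \<alpha> p (A i) * (f (B i (A j y)) * \<beta> q (B j))"]
      sum_pairs[of "\<lambda>i j. \<alpha> p (\<lambda>x. A i (A j x)) * (f (B j y) * \<beta> q (B i))"] .
  moreover have "(\<Sum>i\<in>I. \<Sum>j\<in>I. \<alpha> p (A i) * (f (B i (A j y)) * \<beta> q (B j))) = f (B p (A q y))"
    by (simp only: sum_distrib_left[symmetric] sum_beta_B[OF q] sum_alpha_A[OF p])
  moreover have "(\<Sum>i\<in>I. \<Sum>j\<in>I. \<alpha> p (\<lambda>x. A i (A j x)) * (f (B j y) * \<beta> q (B i))) =
      (\<Sum>j\<in>I. \<alpha> p (\<lambda>x. A q (A j x)) * f (B j y))"
    by (subst sum.swap) (simp only: mult.assoc[symmetric] sum_beta_B[OF q])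
  ultimately show "f (B p (A q y)) = f (\<Sum>j\<in>I. scale (\<alpha> p (\<lambda>x. A q (A j x))) (B j y))"
    by (simp add: linear_sum[OF f] linear_scale[OF f])
qed

text \<open>Contract slots one and two of \<open>assoc_R\<close> with \<open>\<alpha> p\<close> and
  \<open>\<alpha> q\<close>; on the right \<open>\<alpha> p\<close> forces \<open>i = p\<close>. So
  the span of the \<open>B j\<close> is closed under composition.\<close>

lemma B_B:
  assumes p: "p \<in> I" and q: "q \<in> I"
  shows "B p (B q y) = (\<Sum>j\<in>I. scale (\<alpha> q (\<lambda>x. A j (B p x))) (B j y))"
proof (rule functionals_separate)
  fix f assume f: "Vector_Spaces.linear scale (*) f"
  have "(\<Sum>i\<in>I. \<Sum>j\<in>I. \<alpha> p (A i) * (\<alpha> q (A j) * f (B i (B j y)))) =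
      (\<Sum>i\<in>I. \<Sum>j\<in>I. \<alpha> p (A i) * (\<alpha> q (\<lambda>x. A j (B i x)) * f (B j y)))"
    using pure3_sum_contract[where P = "\<lambda>k. A (fst k)" and Q = "\<lambda>k. A (snd k)"
        and S = "\<lambda>k z. B (fst k) (B (snd k) z)" and P' = "\<lambda>k. A (fst k)"
        and Q' = "\<lambda>k y. A (snd k) (B (fst k) y)" and S' = "\<lambda>k. B (snd k)",
        OF assoc_R linear_alpha[OF p] linear_alpha[OF q] linear_evaluation[OF f, of y]]
    unfolding sum_pairs[of "\<lambda>i j. \<alpha> p (A i) * (\<alpha> q (A j) * f (B i (B j y)))"]
      sum_pairs[of "\<lambda>i j. \<alpha> p (A i) * (\<alpha> q (\<lambda>x. A j (B i x)) * f (B j y))"] .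
  moreover have "(\<Sum>i\<in>I. \<Sum>j\<in>I. \<alpha> p (A i) * (\<alpha> q (A j) * f (B i (B j y)))) = f (B p (B q y))"
    by (simp only: sum_distrib_left[symmetric] sum_alpha_A[OF p] sum_alpha_A[OF q])
  moreover have "(\<Sum>i\<in>I. \<Sum>j\<in>I. \<alpha> p (A i) * (\<alpha> q (\<lambda>x. A j (B i x)) * f (B j y))) =
      (\<Sum>j\<in>I. \<alpha> q (\<lambda>x. A j (B p x)) * f (B j y))"
    by (simp only: sum_distrib_left[symmetric] sum_alpha_A[OF p])
  ultimately show "f (B p (B q y)) = f (\<Sum>j\<in>I. scale (\<alpha> q (\<lambda>x. A j (B p x))) (B j y))"
    by (simp add: linear_sum[OF f] linear_scale[OF f])
qed

subsection \<open>Irreducibility and density\<close>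

lemma bracket_in_left:
  assumes "\<And>i. i \<in> I \<Longrightarrow> A i v \<in> W"
  shows "bracket v w \<in> tensor_subspace W UNIV"
  unfolding bracket_eq tensor_subspace_def
  by (rule fn.span_sum, rule fn.span_base) (use assms in blast)

lemma bracket_in_right:
  assumes "\<And>i. i \<in> I \<Longrightarrow> B i w \<in> W"
  shows "bracket v w \<in> tensor_subspace UNIV W"
  unfolding bracket_eq tensor_subspace_def
  by (rule fn.span_sum, rule fn.span_base) (use assms in blast)

lemma idealI:
  assumes W: "subspace W"
    and "\<And>v w. v \<in> W \<or> w \<in> W \<Longrightarrow>
      bracket v w \<in> tensor_subspace W UNIV \<or> bracket v w \<in> tensor_subspace UNIV W"
  shows "ideal W"
proof -
  have zero: "0 \<in> tensor_subspace W UNIV" "0 \<in> tensor_subspace UNIV W"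
    by (simp_all add: tensor_subspace_def fn.span_zero)
  have "\<exists>p\<in>tensor_subspace W UNIV. \<exists>q\<in>tensor_subspace UNIV W. bracket v w = p + q"
    if vw: "v \<in> W \<or> w \<in> W" for v w
    using assms(2)[OF vw]
  proof
    assume "bracket v w \<in> tensor_subspace W UNIV"
    then show ?thesis
      using zero(2) by (intro bexI[of _ "bracket v w"] bexI[of _ 0]) (rule add_0_right[symmetric])
  next
    assume "bracket v w \<in> tensor_subspace UNIV W"
    then show ?thesis
      using zero(1) by (intro bexI[of _ "bracket v w"] bexI[of _ 0]) (rule add_0_left[symmetric])
  qed
  then show ?thesis using W unfolding ideal_def by blast
qed

lemma ideal_trivial:
  assumes "ideal W"
  shows "W = {0} \<or> W = UNIV"
  using simple assms unfolding simple_def by blast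

lemma B_nonzero: "\<exists>i\<in>I. \<exists>v. B i v \<noteq> 0"
proof (rule ccontr)
  assume "\<not> ?thesis"
  then have "bracket v w = 0" for v w
    unfolding bracket_eq by (intro sum.neutral) (simp add: linear_zero[OF linear_pure_right])
  then show False using simple unfolding simple_def by blast
qed

lemma invariant_ideal:
  assumes "subspace W" "\<And>i v. i \<in> I \<Longrightarrow> v \<in> W \<Longrightarrow> A i v \<in> W"
    "\<And>i v. i \<in> I \<Longrightarrow> v \<in> W \<Longrightarrow> B i v \<in> W"
  shows "ideal W"
  using assms(1)
proof (rule idealI)
  fix v w assume "v \<in> W \<or> w \<in> W"
  then show "bracket v w \<in> tensor_subspace W UNIV \<or> bracket v w \<in> tensor_subspace UNIV W"
  proof
    assume "v \<in> W"
    then have "bracket v w \<in> tensor_subspace W UNIV" by (intro bracket_in_left assms(2))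
    then show ?thesis ..
  next
    assume "w \<in> W"
    then have "bracket v w \<in> tensor_subspace UNIV W" by (intro bracket_in_right assms(3))
    then show ?thesis ..
  qed
qed

lemma subspace_B_vimage:
  assumes "subspace W"
  shows "subspace {v. \<forall>i\<in>I. B i v \<in> W}"
  using assms
  by (auto intro!: subspaceI
      simp: linear_zero[OF linear_B] linear_add[OF linear_B] linear_scale[OF linear_B]
        subspace_0 subspace_add subspace_scale)

text \<open>The common kernel of the \<open>B i\<close> is stable under each \<open>A q\<close>,
  because \<open>B\<^sub>p A\<^sub>q\<close> is a combination of the \<open>B j\<close>. It is thus
  an ideal, and a proper one since some \<open>B i\<close> is nonzero.\<close>

lemma B_kernel:
  assumes "\<And>i. i \<in> I \<Longrightarrow> B i v = 0"
  shows "v = 0"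
proof -
  define K where "K = {v. \<forall>i\<in>I. B i v \<in> {0}}"
  have "ideal K"
  proof (rule invariant_ideal)
    show "subspace K" unfolding K_def by (rule subspace_B_vimage) simp
    show "A i v \<in> K" if "i \<in> I" "v \<in> K" for i v
      using that by (simp add: K_def B_A)
    show "B i v \<in> K" if "i \<in> I" "v \<in> K" for i v
      using that by (simp add: K_def linear_zero[OF linear_B])
  qed
  moreover have "K \<noteq> UNIV" using B_nonzero by (auto simp: K_def)
  ultimately have "K = {0}" using ideal_trivial by blast
  then show ?thesis using assms by (auto simp: K_def)
qed

text \<open>Every bracket has its right factors in \<open>W\<close>, which makes \<open>W\<close> an
  ideal whatever the \<open>A i\<close> do to it.\<close>

lemma B_range:
  assumes "subspace W" "\<And>i v. i \<in> I \<Longrightarrow> B i v \<in> W"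
  shows "W = UNIV"
proof -
  have "ideal W"
    using assms(1) by (rule idealI) (rule disjI2, rule bracket_in_right, rule assms(2))
  moreover have "W \<noteq> {0}" using B_nonzero assms(2) by blast
  ultimately show ?thesis using ideal_trivial by blast
qed

text \<open>\<open>W\<close> itself may fail to be stable under the \<open>A i\<close>. The larger
  space \<open>W'\<close> of vectors that all \<open>B i\<close> send into \<open>W\<close> is
  stable by \<open>B_A\<close>, hence is all of V; then \<open>W\<close> contains the ranges of all
  \<open>B i\<close> and \<open>B_range\<close> applies.\<close>

lemma B_irreducible:
  assumes W: "subspace W" and inv: "\<And>i v. i \<in> I \<Longrightarrow> v \<in> W \<Longrightarrow> B i v \<in> W"
    and w: "w \<in> W" "w \<noteq> 0"
  shows "W = UNIV"
proof -
  define W' where "W' = {v. \<forall>i\<in>I. B i v \<in> W}"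
  have "ideal W'"
  proof (rule invariant_ideal)
    show "subspace W'" unfolding W'_def using W by (rule subspace_B_vimage)
    show "A i v \<in> W'" if "i \<in> I" "v \<in> W'" for i v
      using that W by (auto simp: W'_def B_A intro!: subspace_sum subspace_scale)
    show "B i v \<in> W'" if "i \<in> I" "v \<in> W'" for i v
      using that inv by (simp add: W'_def)
  qed
  moreover have "W' \<noteq> {0}" using w inv by (auto simp: W'_def)
  ultimately have "W' = UNIV" using ideal_trivial by blast
  then have "B i v \<in> W" if "i \<in> I" for i v using that unfolding W'_def by blast
  with W show ?thesis by (rule B_range)
qed

section \<open>The identity lies in the span of the operators \<open>B i\<close>\<close>

lemma span_B_coefficients:
  assumes "T \<in> op.span (B ` I)"
  obtains c where "\<And>v. T v = (\<Sum>i\<in>I. scale (c i) (B i v))"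
proof -
  obtain c where "T = (\<Sum>i\<in>I. op_scale (c i) (B i))"
    using op.span_image_coefficients[OF finite_I assms] by blast
  then have "T v = (\<Sum>i\<in>I. scale (c i) (B i v))" for v
    by (simp add: sum_fun_apply op_scale_def)
  then show thesis by (rule that)
qed

lemma linear_span_B:
  assumes "T \<in> op.span (B ` I)"
  shows "Vector_Spaces.linear scale scale T"
proof -
  obtain c where T: "\<And>v. T v = (\<Sum>i\<in>I. scale (c i) (B i v))"
    using span_B_coefficients[OF assms] by blast
  have "T (v + w) = T v + T w" for v w
    unfolding T sum.distrib[symmetric]
    by (intro sum.cong refl) (simp add: linear_add[OF linear_B] scale_right_distrib)
  moreover have "T (scale r v) = scale r (T v)" for r v
    unfolding T scale_sum_right
    by (intro sum.cong refl) (simp add: linear_scale[OF linear_B] mult.commute)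
  ultimately show ?thesis by (simp add: Vector_Spaces.linear_iff vector_space_axioms)
qed

lemma sum_B_in_span: "(\<lambda>v. \<Sum>i\<in>I. scale (c i) (B i v)) \<in> op.span (B ` I)"
proof -
  have "(\<lambda>v. \<Sum>i\<in>I. scale (c i) (B i v)) = (\<Sum>i\<in>I. op_scale (c i) (B i))"
    by (simp add: fun_eq_iff sum_fun_apply op_scale_def)
  then show ?thesis by (simp only:) (intro op.span_sum op.span_scale op.span_base imageI)
qed

lemma span_B_comp:
  assumes p: "p \<in> I" and T: "T \<in> op.span (B ` I)"
  shows "(\<lambda>v. B p (T v)) \<in> op.span (B ` I)"
proof -
  obtain c where "\<And>v. T v = (\<Sum>i\<in>I. scale (c i) (B i v))"
    using span_B_coefficients[OF T] by blast
  then have "(\<lambda>v. B p (T v)) = (\<Sum>i\<in>I. op_scale (c i) (\<lambda>v. B p (B i v)))"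
    by (simp add: fun_eq_iff sum_fun_apply op_scale_def linear_sum[OF linear_B[OF p]]
        linear_scale[OF linear_B[OF p]])
  moreover have "(\<lambda>v. B p (B i v)) \<in> op.span (B ` I)" if "i \<in> I" for i
    by (simp only: B_B[OF p that] sum_B_in_span)
  ultimately show ?thesis by (simp only:) (intro op.span_sum op.span_scale)
qed

text \<open>Density argument, adding one vector \<open>u\<close> at a time: an operator that fixes
  \<open>S\<close> either fixes \<open>u\<close> already or can be adjusted to do so.\<close>

lemma local_identity:
  assumes "finite S"
  shows "\<exists>T \<in> op.span (B ` I). \<forall>v\<in>S. T v = v"
  using assms
proof (induction S)
  case empty
  show ?case using op.span_zero by blast
next
  case (insert u S)
  then obtain T where T: "T \<in> op.span (B ` I)" "\<And>v. v \<in> S \<Longrightarrow> T v = v" by blast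
  \<comment> \<open>\<open>J\<close> is the annihilator of \<open>S\<close> in the span and is
    closed under left composition with each \<open>B i\<close>. Hence its values at \<open>u\<close>
    form a subspace \<open>W\<close> stable under the \<open>B i\<close>, which is
    \<open>{0}\<close> or V.\<close>
  define J where "J = {X \<in> op.span (B ` I). \<forall>v\<in>S. X v = 0}"
  define W where "W = (\<lambda>X. X u) ` J"
  have J: "op.subspace J"
    unfolding J_def
    by (auto intro!: op.subspaceI op.span_zero op.span_add op.span_scale simp: op_scale_def)
  have W: "subspace W"
  proof (rule subspaceI)
    show "0 \<in> W" unfolding W_def using op.subspace_0[OF J] by (rule rev_image_eqI) simp
    show "x + y \<in> W" if "x \<in> W" "y \<in> W" for x y
    proof -
      from that obtain X Y where XY: "X \<in> J" "Y \<in> J" "x = X u" "y = Y u" unfolding W_def by blast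
      have "(X + Y) u \<in> W"
        unfolding W_def using op.subspace_add[OF J XY(1,2)] by (rule imageI)
      then show ?thesis by (simp add: XY)
    qed
    show "scale c x \<in> W" if "x \<in> W" for c x
    proof -
      from that obtain X where X: "X \<in> J" "x = X u" unfolding W_def by blast
      have "op_scale c X u \<in> W"
        unfolding W_def using op.subspace_scale[OF J X(1)] by (rule imageI)
      then show ?thesis by (simp add: X op_scale_def)
    qed
  qed
  have inv: "B i w \<in> W" if i: "i \<in> I" and w: "w \<in> W" for i w
  proof -
    obtain X where X: "X \<in> J" "w = X u" using w unfolding W_def by blast
    then have "(\<lambda>v. B i (X v)) \<in> J"
      using i by (simp add: J_def span_B_comp linear_zero[OF linear_B])
    then show ?thesis unfolding W_def X(2) by (rule rev_image_eqI) simp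
  qed
  txt \<open>
    If \<open>J\<close> annihilates \<open>u\<close>, then \<open>B\<^sub>i - B\<^sub>i T \<in> J\<close> gives \<open>T u = u\<close>; otherwise \<open>J u = V\<close> by irreducibility,
    and \<open>T\<close> can be corrected by an element of \<open>J\<close>.
  \<close>
  show ?case
  proof (cases "W = {0}")
    case True
    have "B i (u - T u) = 0" if i: "i \<in> I" for i
    proof -
      have "B i - (\<lambda>v. B i (T v)) \<in> J"
        using T op.span_diff[OF op.span_base[OF imageI[OF i]] span_B_comp[OF i T(1)]]
        by (simp add: J_def)
      then have "(B i - (\<lambda>v. B i (T v))) u \<in> W" unfolding W_def by (rule imageI)
      then show ?thesis using True by (simp add: linear_diff[OF linear_B[OF i]])
    qed
    then have "u - T u = 0" by (rule B_kernel)
    then have "\<forall>v\<in>insert u S. T v = v" using T(2) by simp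
    then show ?thesis using T(1) by (rule rev_bexI[rotated])
  next
    case False
    then obtain w where "w \<in> W" "w \<noteq> 0" using subspace_0[OF W] by blast
    then have "W = UNIV" using B_irreducible[OF W inv] by blast
    then obtain X where X: "X \<in> J" "X u = u - T u" unfolding W_def by (metis UNIV_I imageE)
    have "X + T \<in> op.span (B ` I)"
      using X(1) T(1) by (auto simp: J_def intro: op.span_add)
    moreover have "\<forall>v\<in>insert u S. (X + T) v = v"
      using X T(2) by (auto simp: J_def)
    ultimately show ?thesis by blast
  qed
qed

text \<open>An operator of the span is linear, so fixing a finite spanning set makes it the
  identity.\<close>

lemma identity_in_span_B:
  assumes E: "finite E" "span E = UNIV"
  shows "id \<in> op.span (B ` I)"
proof -
  obtain T where T: "T \<in> op.span (B ` I)" "\<And>v. v \<in> E \<Longrightarrow> T v = v"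
    using local_identity[OF E(1)] by blast
  have "T v = v" for v
  proof -
    have "v \<in> span E" using E(2) by simp
    then show ?thesis
      by (induction rule: span_induct_alt)
        (simp_all add: T(2) linear_zero[OF linear_span_B[OF T(1)]]
          linear_add[OF linear_span_B[OF T(1)]] linear_scale[OF linear_span_B[OF T(1)]])
  qed
  then have "T = id" by (simp add: fun_eq_iff)
  then show ?thesis using T(1) by simp
qed

subsection \<open>Symmetry of the bracket\<close>

lemma bracket_symmetric:
  assumes E: "finite E" "span E = UNIV"
  shows "bracket x y = (\<Sum>i\<in>I. pure [B i x, A i y])"
proof -
  obtain c where c: "\<And>v. v = (\<Sum>i\<in>I. scale (c i) (B i v))"
    using span_B_coefficients[OF identity_in_span_B[OF E]] unfolding id_apply by blast
  \<comment> \<open>The \<open>c i\<close> are coordinates of the identity. Summing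
    \<open>B_A\<close> over \<open>p\<close> with weights \<open>c p\<close> turns
    \<open>B p\<close> into the identity and \<open>\<alpha> p\<close> into
    \<open>\<epsilon>\<close>.\<close>
  define \<epsilon> where "\<epsilon> X = (\<Sum>i\<in>I. c i * \<alpha> i X)" for X
  define g where "g i j = \<epsilon> (\<lambda>x. A i (A j x))" for i j
  have \<epsilon>_linear: "\<epsilon> (\<lambda>x. \<Sum>k\<in>I. scale (s k) (X k x)) = (\<Sum>k\<in>I. s k * \<epsilon> (X k))" for s X
  proof -
    have "\<alpha> i (\<lambda>x. \<Sum>k\<in>I. scale (s k) (X k x)) = (\<Sum>k\<in>I. s k * \<alpha> i (X k))" if "i \<in> I" for i
    proof -
      have "(\<lambda>x. \<Sum>k\<in>I. scale (s k) (X k x)) = (\<Sum>k\<in>I. op_scale (s k) (X k))"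
        by (simp add: fun_eq_iff sum_fun_apply op_scale_def)
      then show ?thesis
        by (simp add: linear_sum[OF linear_alpha[OF that]] linear_scale[OF linear_alpha[OF that]])
    qed
    then have "\<epsilon> (\<lambda>x. \<Sum>k\<in>I. scale (s k) (X k x)) = (\<Sum>i\<in>I. \<Sum>k\<in>I. c i * (s k * \<alpha> i (X k)))"
      unfolding \<epsilon>_def by (simp add: sum_distrib_left)
    also have "\<dots> = (\<Sum>k\<in>I. s k * \<epsilon> (X k))"
      unfolding \<epsilon>_def by (subst sum.swap) (simp add: sum_distrib_left mult.left_commute)
    finally show ?thesis .
  qed
  have A_eq: "A q v = (\<Sum>j\<in>I. scale (g q j) (B j v))" if q: "q \<in> I" for q v
  proof -
    have "A q v = (\<Sum>p\<in>I. scale (c p) (B p (A q v)))" by (rule c)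
    also have "\<dots> = (\<Sum>p\<in>I. \<Sum>j\<in>I. scale (c p * \<alpha> p (\<lambda>x. A q (A j x))) (B j v))"
      by (intro sum.cong refl) (simp add: B_A q scale_sum_right)
    also have "\<dots> = (\<Sum>j\<in>I. scale (g q j) (B j v))"
      unfolding g_def \<epsilon>_def by (subst sum.swap) (simp add: scale_sum_left)
    finally show ?thesis .
  qed
  \<comment> \<open>Here the identity is inserted behind \<open>B p\<close>, so the weighted sum
    runs over the second index of \<open>B_B\<close>.\<close>
  have B_expand: "B p v = (\<Sum>j\<in>I. scale (\<epsilon> (\<lambda>x. A j (B p x))) (B j v))" if p: "p \<in> I" for p v
  proof -
    have "B p v = B p (\<Sum>q\<in>I. scale (c q) (B q v))" by (subst c[of v]) (rule refl)
    also have "\<dots> = (\<Sum>q\<in>I. \<Sum>j\<in>I. scale (c q * \<alpha> q (\<lambda>x. A j (B p x))) (B j v))"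
      by (simp add: linear_sum[OF linear_B[OF p]] linear_scale[OF linear_B[OF p]] B_B p
          scale_sum_right)
    also have "\<dots> = (\<Sum>j\<in>I. scale (\<epsilon> (\<lambda>x. A j (B p x))) (B j v))"
      unfolding \<epsilon>_def by (subst sum.swap) (simp add: scale_sum_left)
    finally show ?thesis .
  qed
  \<comment> \<open>Applying \<open>\<beta> j\<close> compares the coefficients of
    \<open>B j\<close> on both sides of \<open>B_expand\<close>.\<close>
  have dual: "\<epsilon> (\<lambda>x. A j (B p x)) = (if j = p then 1 else 0)" if j: "j \<in> I" and p: "p \<in> I" for j p
  proof -
    have "B p = (\<Sum>k\<in>I. op_scale (\<epsilon> (\<lambda>x. A k (B p x))) (B k))"
      by (rule ext, subst B_expand[OF p]) (simp add: sum_fun_apply op_scale_def)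
    then have "\<beta> j (B p) = \<beta> j (\<Sum>k\<in>I. op_scale (\<epsilon> (\<lambda>x. A k (B p x))) (B k))"
      by (rule arg_cong)
    also have "\<dots> = (\<Sum>k\<in>I. \<epsilon> (\<lambda>x. A k (B p x)) * \<beta> j (B k))"
      by (simp only: linear_sum[OF linear_beta[OF j]] linear_scale[OF linear_beta[OF j]])
    also have "\<dots> = \<epsilon> (\<lambda>x. A j (B p x))" by (rule sum_beta_B[OF j])
    finally show ?thesis using j p by (simp add: beta_B)
  qed
  \<comment> \<open>Only the inner operator of \<open>A\<^sub>j A\<^sub>q\<close> is expanded by
    \<open>A_eq\<close>; \<open>dual\<close> then selects the term \<open>k = j\<close>.\<close>
  have sym: "g j q = g q j" if j: "j \<in> I" and q: "q \<in> I" for j q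
  proof -
    have "(\<lambda>x. A j (A q x)) = (\<lambda>x. \<Sum>k\<in>I. scale (g q k) (A j (B k x)))"
      by (simp add: A_eq[OF q] linear_sum[OF linear_A[OF j]] linear_scale[OF linear_A[OF j]])
    then have "g j q = (\<Sum>k\<in>I. g q k * \<epsilon> (\<lambda>x. A j (B k x)))"
      unfolding g_def[of j q] by (simp only: \<epsilon>_linear)
    also have "\<dots> = (\<Sum>k\<in>I. if j = k then g q k else 0)"
      by (intro sum.cong refl) (simp add: dual j)
    also have "\<dots> = g q j" using j finite_I by simp
    finally show ?thesis .
  qed
  \<comment> \<open>\<open>A_eq\<close> expands the left factors; after the coefficients are
    exchanged by \<open>sym\<close>, they are absorbed into the right factors by \<open>A_eq\<close>
    read backwards.\<close>
  have "bracket x y = (\<Sum>q\<in>I. \<Sum>j\<in>I. fun_scale (g q j) (pure [B j x, B q y]))"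
    unfolding bracket_eq by (intro sum.cong refl) (simp add: A_eq pure2_sum pure2_scale)
  also have "\<dots> = (\<Sum>j\<in>I. \<Sum>q\<in>I. fun_scale (g j q) (pure [B j x, B q y]))"
    by (subst sum.swap) (intro sum.cong refl, simp add: sym)
  also have "\<dots> = (\<Sum>j\<in>I. pure [B j x, A j y])"
    by (intro sum.cong refl) (simp add: A_eq pure2_sum pure2_scale)
  finally show ?thesis .
qed

lemma commutative:
  assumes E: "finite E" "span E = UNIV"
  shows commutative
proof -
  have perm: "transpose 0 1 permutes {..<2::nat}" by (rule permutes_swap_id) simp_all
  have "tensor_perm 2 (transpose 0 1) (pure [u, v]) = pure [v, u]" for u v
    by (simp add: tensor_perm_pure[OF perm, simplified] permute_list_def transpose_def)
  then have "tensor_perm 2 (transpose 0 1) (bracket b a) = (\<Sum>i\<in>I. pure [B i a, A i b])" for a b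
    by (simp only: bracket_eq linear_sum[OF linear_tensor_perm[OF perm]])
  then show ?thesis
    using assoc bracket_symmetric[OF E] unfolding commutative_def by simp
qed

end

theorem theorem3:
  fixes scale :: "'k::field \<Rightarrow> 'v::ab_group_add \<Rightarrow> 'v"
    and D :: "('v, 'k) tensor \<Rightarrow> ('v, 'k) tensor"
  assumes "double_algebra scale D"
    and "\<exists>B. finite B \<and> module.span scale B = UNIV"
    and "double_algebra.simple scale D"
    and "double_algebra.associative scale D"
  shows "double_algebra.commutative scale D"
proof -
  interpret double_algebra scale D by fact
  obtain E where E: "finite E" "span E = UNIV" using assms(2) by blast
  have "finite_rank bracket"
    by (rule finite_rank_bilinear[OF E linear_bracket_left linear_bracket_right bracket_in])
  then obtain I A B where dec: "decomposition bracket I A B"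
    and indep: "\<And>i. i \<in> I \<Longrightarrow> A i \<notin> op.span (A ` (I - {i}))"
      "\<And>i. i \<in> I \<Longrightarrow> B i \<notin> op.span (B ` (I - {i}))"
    by (rule minimal_decomposition) (rule that)
  \<comment> \<open>Independence of both families, in the space of operators, yields the two systems
    of dual functionals.\<close>
  obtain \<alpha> where \<alpha>: "\<And>i. i \<in> I \<Longrightarrow> Vector_Spaces.linear op_scale (*) (\<alpha> i)"
    "\<And>i j. i \<in> I \<Longrightarrow> j \<in> I \<Longrightarrow> \<alpha> i (A j) = (if i = j then 1 else 0)"
    using op.dual_functionals[OF indep(1)] by blast
  obtain \<beta> where \<beta>: "\<And>i. i \<in> I \<Longrightarrow> Vector_Spaces.linear op_scale (*) (\<beta> i)"
    "\<And>i j. i \<in> I \<Longrightarrow> j \<in> I \<Longrightarrow> \<beta> i (B j) = (if i = j then 1 else 0)"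
    using op.dual_functionals[OF indep(2)] by blast
  interpret dual_decomposition scale D I A B \<alpha> \<beta>
    by (intro dual_decomposition.intro dual_decomposition_axioms.intro double_algebra_axioms)
      (fact dec \<alpha> \<beta> assms(3,4))+
  show ?thesis using E by (rule commutative)
qed

end
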